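(* Let $\alpha,\beta\ge 0$ with $\alpha+\beta>0$, and put $k=\frac{\alpha-\beta}{\alpha+\beta}$. If $k\in\{-1,1\}$ (i.e. exactly one of $\alpha,\beta$ is zero), then the generalized Taub-NUT Kähler surface $(\mathbb C^2,g,J)$ with parameters $\alpha,\beta$ (an exceptional generalized Taub-NUT surface) is a QCH Kähler surface of Calabi type.
   Context: Generalized Taub-NUT Kähler surface with parameters $\alpha,\beta\ge0$, $\alpha+\beta>0$ (with $k=\frac{\alpha-\beta}{\alpha+\beta}$, $M=\frac{\alpha+\beta}{2\sqrt2}$): on the half plane $\Sigma$ with interior $\{(x,y)\in\mathbb R^2: x>0\}$ consider $$\psi_1=\tfrac{1}{\sqrt2}\big(-y+\sqrt{x^2+y^2}\big)+\tfrac{\alpha}{2}x^2,\qquad \psi_2=\tfrac{1}{\sqrt2}\big(y+\sqrt{x^2+y^2}\big)+\tfrac{\beta}{2}x^2,$$ $$g_\Sigma=\frac{1+2M(ky+\sqrt{x^2+y^2})}{\sqrt{x^2+y^2}}\,(dx\otimes dx+dy\otimes dy).$$ Let $G^{ij}=g_\Sigma(\nabla\psi_i,\nabla\psi_j)$, $i,j=1,2$ (gradients with respect to $g_\Sigma$). On $\{x>0\}\times T^2$, with angular coordinates $\theta_1,\theta_2$ (each taken modulo $2\sqrt2\pi$) on $T^2$, put $$g=g_\Sigma+\sum_{i,j}G^{ij}\,d\theta_i\,d\theta_j,\qquad \omega=d\psi_1\wedge d\theta_1+d\psi_2\wedge d\theta_2,$$ and let $J$ be defined by $\omega(X,Y)=g(JX,Y)$.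 This Kähler structure is regarded as living on the open dense subset $(\mathbb C\setminus\{0\})^2\subset\mathbb C^2$ via $z_1=v\,e^{i\theta_1/\sqrt2}$, $z_2=u\,e^{i\theta_2/\sqrt2}$, where $u,v>0$, $u^2=M(\sqrt{x^2+y^2}+y)$, $v^2=M(\sqrt{x^2+y^2}-y)$ (so $x=uv/M$); it extends smoothly to all of $\mathbb C^2=\mathbb R^4$ (as a smooth manifold), and the extension is the generalized Taub-NUT Kähler surface. QCH Kähler surface: a Kähler surface $(N,g,J)$ (real dimension 4) admitting a global 2-dimensional $J$-invariant distribution $\mathcal D\subset TN$ such that, for every $p\in N$ and every $J$-invariant 2-plane $\pi\subset T_pN$ with $X\in\pi$, $g(X,X)=1$, the holomorphic curvature $K(\pi)=R(X,JX,JX,X)$ depends only on the point $p$ and the number $|X_{\mathcal D}|=\sqrt{g(X_{\mathcal D},X_{\mathcal D})}$, where $X_{\mathcal D}$ is the orthogonal projection of $X$ onto $\mathcal D$. Its opposite almost Hermitian structure $I$ is the $g$-orthogonal almost complex structure with $I=J$ on $\mathcal D$ and $I=-J$ on $\mathcal D^\perp$ (defined up to sign); its Kähler form $\omega_I(X,Y)=g(IX,Y)$ is anti-selfdual for the orientation of $J$. When $I$ is integrable, its Lee form $\theta$ is defined by $d\omega_I=2\theta\wedge\omega_I$. Calabi type Kähler surface: a QCH Kähler surface such that $I$ is integrable (Hermitian), $|\nabla I|>0$ everywhere, one of the distributions $\mathcal D,\mathcal D^\perp$ coincides with $\mathcal D_0=\operatorname{span}\{\theta^\sharp,I\theta^\sharp\}=\{X:\nabla_XI=0\}$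 ("generalized Calabi type"), and in addition $(g,I)$ is locally conformally Kähler. A QCH Kähler surface $(N,g,J)$ is said to be of Calabi type if there is an open dense subset $U\subset N$ such that $(U,g|_U,J|_U)$ is a Calabi type Kähler surface in this sense. *)

theory Defs
  imports "HOL-Analysis.Analysis"
begin

text \<open>
  Manifolds are open subsets \<open>S\<close> of a Euclidean space \<open>'a\<close>, with every tangent space identified
  with \<open>'a\<close>.  A tensor field maps a point to a multilinear map of tangent vectors; values at
  points outside \<open>S\<close> are irrelevant.  A tangent vector \<open>X\<close>, used as a vector field, means the
  constant field \<open>\<lambda>_. X\<close>.
\<close>

section \<open>Smooth tensor fields\<close>

primrec C_k_on :: "nat \<Rightarrow> ('a::euclidean_space \<Rightarrow> 'b::real_normed_vector) \<Rightarrow> 'a set \<Rightarrow> bool" where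
  "C_k_on 0 f S \<longleftrightarrow> continuous_on S f"
| "C_k_on (Suc n) f S \<longleftrightarrow>
     (\<forall>p\<in>S. f differentiable (at p)) \<and>
     (\<forall>X. C_k_on n (\<lambda>p. frechet_derivative f (at p) X) S)"

text \<open>Meaningful for open \<open>S\<close> only.\<close>

definition smooth_on :: "'a set \<Rightarrow> ('a::euclidean_space \<Rightarrow> 'b::real_normed_vector) \<Rightarrow> bool" where
  "smooth_on S f \<longleftrightarrow> (\<forall>n. C_k_on n f S)"

type_synonym 'a two_tensor = "'a \<Rightarrow> 'a \<Rightarrow> 'a \<Rightarrow> real"
type_synonym 'a endo_field = "'a \<Rightarrow> 'a \<Rightarrow> 'a"
type_synonym 'a one_form = "'a \<Rightarrow> 'a \<Rightarrow> real"

definition smooth_two_tensor :: "'a::euclidean_space set \<Rightarrow> 'a two_tensor \<Rightarrow> bool" where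
  "smooth_two_tensor S h \<longleftrightarrow>
     (\<forall>p\<in>S. bilinear (h p)) \<and> (\<forall>X Y. smooth_on S (\<lambda>p. h p X Y))"

definition smooth_endo :: "'a::euclidean_space set \<Rightarrow> 'a endo_field \<Rightarrow> bool" where
  "smooth_endo S A \<longleftrightarrow> (\<forall>p\<in>S. linear (A p)) \<and> (\<forall>X. smooth_on S (\<lambda>p. A p X))"

definition smooth_one_form :: "'a::euclidean_space set \<Rightarrow> 'a one_form \<Rightarrow> bool" where
  "smooth_one_form S \<phi> \<longleftrightarrow> (\<forall>p\<in>S. linear (\<phi> p)) \<and> (\<forall>X. smooth_on S (\<lambda>p. \<phi> p X))"

definition riemannian_metric :: "'a::euclidean_space set \<Rightarrow> 'a two_tensor \<Rightarrow> bool" where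
  "riemannian_metric S g \<longleftrightarrow> smooth_two_tensor S g \<and>
     (\<forall>p\<in>S. (\<forall>X Y. g p X Y = g p Y X) \<and> (\<forall>X. X \<noteq> 0 \<longrightarrow> g p X X > 0))"

definition sharp :: "'a two_tensor \<Rightarrow> 'a \<Rightarrow> ('a::euclidean_space \<Rightarrow> real) \<Rightarrow> 'a" where
  "sharp g p \<phi> = (THE Z. \<forall>W. g p Z W = \<phi> W)"

section \<open>Levi-Civita connection and curvature\<close>

text \<open>Koszul's formula for constant fields.\<close>

definition christoffel :: "'a::euclidean_space two_tensor \<Rightarrow> 'a \<Rightarrow> 'a \<Rightarrow> 'a \<Rightarrow> 'a" where
  "christoffel g p X Y = sharp g p (\<lambda>W.
     (frechet_derivative (\<lambda>q. g q Y W) (at p) X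
    + frechet_derivative (\<lambda>q. g q X W) (at p) Y
    - frechet_derivative (\<lambda>q. g q X Y) (at p) W) / 2)"

definition nabla ::
  "'a::euclidean_space two_tensor \<Rightarrow> ('a \<Rightarrow> 'a) \<Rightarrow> ('a \<Rightarrow> 'a) \<Rightarrow> 'a \<Rightarrow> 'a" where
  "nabla g X Y p = frechet_derivative Y (at p) (X p) + christoffel g p (X p) (Y p)"

definition lie_bracket :: "('a::euclidean_space \<Rightarrow> 'a) \<Rightarrow> ('a \<Rightarrow> 'a) \<Rightarrow> 'a \<Rightarrow> 'a" where
  "lie_bracket X Y p = frechet_derivative Y (at p) (X p) - frechet_derivative X (at p) (Y p)"

definition curvature_op ::
  "'a::euclidean_space two_tensor \<Rightarrow> ('a \<Rightarrow> 'a) \<Rightarrow> ('a \<Rightarrow> 'a) \<Rightarrow> ('a \<Rightarrow> 'a) \<Rightarrow> 'a \<Rightarrow> 'a" where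
  "curvature_op g X Y Z p =
     nabla g X (nabla g Y Z) p - nabla g Y (nabla g X Z) p - nabla g (lie_bracket X Y) Z p"

text \<open>\<open>R(X,Y,Z,W) = g(R(X,Y)Z, W)\<close>, so that \<open>R(X,Y,Y,X)\<close> is positive on round spheres.\<close>

definition curvature :: "'a::euclidean_space two_tensor \<Rightarrow> 'a \<Rightarrow> 'a \<Rightarrow> 'a \<Rightarrow> 'a \<Rightarrow> 'a \<Rightarrow> real" where
  "curvature g p X Y Z W = g p (curvature_op g (\<lambda>_. X) (\<lambda>_. Y) (\<lambda>_. Z) p) W"

text \<open>\<open>(\<nabla>\<^sub>X A) Y = \<nabla>\<^sub>X (A Y) - A (\<nabla>\<^sub>X Y)\<close>.\<close>

definition nabla_endo ::
  "'a::euclidean_space two_tensor \<Rightarrow> 'a endo_field \<Rightarrow> 'a \<Rightarrow> 'a \<Rightarrow> 'a \<Rightarrow> 'a" where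
  "nabla_endo g A p X Y =
     nabla g (\<lambda>_. X) (\<lambda>q. A q Y) p - A p (nabla g (\<lambda>_. X) (\<lambda>_. Y) p)"

definition orthonormal_basis :: "'a::euclidean_space two_tensor \<Rightarrow> 'a \<Rightarrow> 'a set \<Rightarrow> bool" where
  "orthonormal_basis g p B \<longleftrightarrow>
     span B = UNIV \<and> (\<forall>e\<in>B. \<forall>f\<in>B. g p e f = (if e = f then 1 else 0))"

text \<open>The value does not depend on the chosen orthonormal basis.\<close>

definition norm_nabla_endo :: "'a::euclidean_space two_tensor \<Rightarrow> 'a endo_field \<Rightarrow> 'a \<Rightarrow> real" where
  "norm_nabla_endo g A p =
     (let B = SOME B. orthonormal_basis g p B
      in sqrt (\<Sum>e\<in>B. \<Sum>f\<in>B. g p (nabla_endo g A p e f) (nabla_endo g A p e f)))"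

section \<open>Hermitian and Kaehler structures\<close>

text \<open>Exterior products and derivatives follow the convention without factorial factors,
  \<open>(\<phi> \<and> \<chi>)(X,Y) = \<phi>(X)\<chi>(Y) - \<phi>(Y)\<chi>(X)\<close>.\<close>

definition wedge_1_2 ::
  "('a \<Rightarrow> real) \<Rightarrow> ('a \<Rightarrow> 'a \<Rightarrow> real) \<Rightarrow> 'a \<Rightarrow> 'a \<Rightarrow> 'a \<Rightarrow> real" where
  "wedge_1_2 \<phi> \<omega> X Y Z = \<phi> X * \<omega> Y Z + \<phi> Y * \<omega> Z X + \<phi> Z * \<omega> X Y"

definition ext_deriv2 :: "'a::euclidean_space two_tensor \<Rightarrow> 'a \<Rightarrow> 'a \<Rightarrow> 'a \<Rightarrow> 'a \<Rightarrow> real" where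
  "ext_deriv2 \<omega> p X Y Z =
     frechet_derivative (\<lambda>q. \<omega> q Y Z) (at p) X
   + frechet_derivative (\<lambda>q. \<omega> q Z X) (at p) Y
   + frechet_derivative (\<lambda>q. \<omega> q X Y) (at p) Z"

definition nijenhuis :: "'a::euclidean_space endo_field \<Rightarrow> 'a \<Rightarrow> 'a \<Rightarrow> 'a \<Rightarrow> 'a" where
  "nijenhuis J p X Y =
     lie_bracket (\<lambda>q. J q X) (\<lambda>q. J q Y) p
   - J p (lie_bracket (\<lambda>q. J q X) (\<lambda>_. Y) p)
   - J p (lie_bracket (\<lambda>_. X) (\<lambda>q. J q Y) p)
   - lie_bracket (\<lambda>_. X) (\<lambda>_. Y) p"

definition almost_hermitian ::
  "'a::euclidean_space set \<Rightarrow> 'a two_tensor \<Rightarrow> 'a endo_field \<Rightarrow> bool" where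
  "almost_hermitian S g J \<longleftrightarrow> riemannian_metric S g \<and> smooth_endo S J \<and>
     (\<forall>p\<in>S. \<forall>X. J p (J p X) = - X) \<and>
     (\<forall>p\<in>S. \<forall>X Y. g p (J p X) (J p Y) = g p X Y)"

definition hermitian ::
  "'a::euclidean_space set \<Rightarrow> 'a two_tensor \<Rightarrow> 'a endo_field \<Rightarrow> bool" where
  "hermitian S g J \<longleftrightarrow> almost_hermitian S g J \<and> (\<forall>p\<in>S. \<forall>X Y. nijenhuis J p X Y = 0)"

definition kaehler_form :: "'a two_tensor \<Rightarrow> 'a endo_field \<Rightarrow> 'a two_tensor" where
  "kaehler_form g J p X Y = g p (J p X) Y"

definition kaehler ::
  "'a::euclidean_space set \<Rightarrow> 'a two_tensor \<Rightarrow> 'a endo_field \<Rightarrow> bool" where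
  "kaehler S g J \<longleftrightarrow> hermitian S g J \<and>
     (\<forall>p\<in>S. \<forall>X Y Z. ext_deriv2 (kaehler_form g J) p X Y Z = 0)"

definition kaehler_surface ::
  "'a::euclidean_space set \<Rightarrow> 'a two_tensor \<Rightarrow> 'a endo_field \<Rightarrow> bool" where
  "kaehler_surface S g J \<longleftrightarrow> DIM('a) = 4 \<and> open S \<and> S \<noteq> {} \<and> kaehler S g J"

definition locally_conformally_kaehler ::
  "'a::euclidean_space set \<Rightarrow> 'a two_tensor \<Rightarrow> 'a endo_field \<Rightarrow> bool" where
  "locally_conformally_kaehler S g J \<longleftrightarrow> hermitian S g J \<and>
     (\<forall>p\<in>S. \<exists>V f. open V \<and> p \<in> V \<and> V \<subseteq> S \<and> smooth_on V f \<and>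
        kaehler V (\<lambda>q X Y. exp (f q) * g q X Y) J)"

definition lee_form ::
  "'a::euclidean_space set \<Rightarrow> 'a two_tensor \<Rightarrow> 'a endo_field \<Rightarrow> 'a one_form \<Rightarrow> bool" where
  "lee_form S g I \<theta> \<longleftrightarrow> smooth_one_form S \<theta> \<and>
     (\<forall>p\<in>S. \<forall>X Y Z. ext_deriv2 (kaehler_form g I) p X Y Z
        = 2 * wedge_1_2 (\<theta> p) (kaehler_form g I p) X Y Z)"

section \<open>QCH Kaehler surfaces\<close>

definition smooth_2_distribution ::
  "'a::euclidean_space set \<Rightarrow> ('a \<Rightarrow> 'a set) \<Rightarrow> bool" where
  "smooth_2_distribution S D \<longleftrightarrow>
     (\<forall>p\<in>S. subspace (D p) \<and> dim (D p) = 2) \<and>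
     (\<forall>p\<in>S. \<exists>V E F. open V \<and> p \<in> V \<and> V \<subseteq> S \<and>
        smooth_on V E \<and> smooth_on V F \<and> (\<forall>q\<in>V. D q = span {E q, F q}))"

definition orth_proj ::
  "'a::euclidean_space two_tensor \<Rightarrow> ('a \<Rightarrow> 'a set) \<Rightarrow> 'a \<Rightarrow> 'a \<Rightarrow> 'a" where
  "orth_proj g D p X = (THE Y. Y \<in> D p \<and> (\<forall>Z\<in>D p. g p (X - Y) Z = 0))"

definition orth_compl ::
  "'a::euclidean_space two_tensor \<Rightarrow> ('a \<Rightarrow> 'a set) \<Rightarrow> 'a \<Rightarrow> 'a set" where
  "orth_compl g D p = {X. \<forall>Y\<in>D p. g p X Y = 0}"

text \<open>The function \<open>K\<close> expresses that the holomorphic curvature depends only on \<open>p\<close> and \<open>|X\<^sub>D|\<close>.\<close>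

definition qch_distribution ::
  "'a::euclidean_space set \<Rightarrow> 'a two_tensor \<Rightarrow> 'a endo_field \<Rightarrow> ('a \<Rightarrow> 'a set) \<Rightarrow> bool" where
  "qch_distribution S g J D \<longleftrightarrow> smooth_2_distribution S D \<and>
     (\<forall>p\<in>S. J p ` D p \<subseteq> D p) \<and>
     (\<exists>K :: 'a \<Rightarrow> real \<Rightarrow> real. \<forall>p\<in>S. \<forall>P.
        subspace P \<and> dim P = 2 \<and> J p ` P \<subseteq> P \<longrightarrow>
        (\<forall>X\<in>P. g p X X = 1 \<longrightarrow>
           curvature g p X (J p X) (J p X) X
             = K p (sqrt (g p (orth_proj g D p X) (orth_proj g D p X)))))"

definition qch_kaehler_surface ::
  "'a::euclidean_space set \<Rightarrow> 'a two_tensor \<Rightarrow> 'a endo_field \<Rightarrow> bool" where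
  "qch_kaehler_surface S g J \<longleftrightarrow> kaehler_surface S g J \<and> (\<exists>D. qch_distribution S g J D)"

text \<open>\<open>I = J\<close> on \<open>D\<close> and \<open>I = -J\<close> on the orthogonal complement of \<open>D\<close>.\<close>

definition opposite_structure ::
  "'a::euclidean_space two_tensor \<Rightarrow> 'a endo_field \<Rightarrow> ('a \<Rightarrow> 'a set) \<Rightarrow> 'a endo_field" where
  "opposite_structure g J D p X = J p (orth_proj g D p X) - J p (X - orth_proj g D p X)"

definition generalized_calabi_type ::
  "'a::euclidean_space set \<Rightarrow> 'a two_tensor \<Rightarrow> 'a endo_field \<Rightarrow> ('a \<Rightarrow> 'a set) \<Rightarrow> bool" where
  "generalized_calabi_type S g J D \<longleftrightarrow>
     kaehler_surface S g J \<and> qch_distribution S g J D \<and>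
     (let I = opposite_structure g J D in
        hermitian S g I \<and> (\<forall>p\<in>S. norm_nabla_endo g I p > 0) \<and>
        (\<exists>\<theta>. lee_form S g I \<theta> \<and>
          (let D0 = (\<lambda>p. span {sharp g p (\<theta> p), I p (sharp g p (\<theta> p))}) in
             (\<forall>p\<in>S. D0 p = {X. \<forall>Y. nabla_endo g I p X Y = 0}) \<and>
             ((\<forall>p\<in>S. D p = D0 p) \<or> (\<forall>p\<in>S. orth_compl g D p = D0 p)))))"

definition calabi_type_kaehler_surface ::
  "'a::euclidean_space set \<Rightarrow> 'a two_tensor \<Rightarrow> 'a endo_field \<Rightarrow> bool" where
  "calabi_type_kaehler_surface S g J \<longleftrightarrow>
     (\<exists>D. generalized_calabi_type S g J D \<and>
          locally_conformally_kaehler S g (opposite_structure g J D))"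

definition qch_of_calabi_type ::
  "'a::euclidean_space set \<Rightarrow> 'a two_tensor \<Rightarrow> 'a endo_field \<Rightarrow> bool" where
  "qch_of_calabi_type S g J \<longleftrightarrow> qch_kaehler_surface S g J \<and>
     (\<exists>U. open U \<and> U \<subseteq> S \<and> S \<subseteq> closure U \<and> calabi_type_kaehler_surface U g J)"

section \<open>Generalized Taub-NUT surfaces\<close>

definition tn_k :: "real \<Rightarrow> real \<Rightarrow> real" where
  "tn_k \<alpha> \<beta> = (\<alpha> - \<beta>) / (\<alpha> + \<beta>)"

definition tn_M :: "real \<Rightarrow> real \<Rightarrow> real" where
  "tn_M \<alpha> \<beta> = (\<alpha> + \<beta>) / (2 * sqrt 2)"

text \<open>Points \<open>(x, y)\<close> of the half plane are pairs; on pairs \<open>dx \<otimes> dx + dy \<otimes> dy\<close> is the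
  inner product.\<close>

definition psi1 :: "real \<Rightarrow> real \<times> real \<Rightarrow> real" where
  "psi1 \<alpha> = (\<lambda>(x, y). (- y + sqrt (x\<^sup>2 + y\<^sup>2)) / sqrt 2 + \<alpha> / 2 * x\<^sup>2)"

definition psi2 :: "real \<Rightarrow> real \<times> real \<Rightarrow> real" where
  "psi2 \<beta> = (\<lambda>(x, y). (y + sqrt (x\<^sup>2 + y\<^sup>2)) / sqrt 2 + \<beta> / 2 * x\<^sup>2)"

definition g_Sigma :: "real \<Rightarrow> real \<Rightarrow> (real \<times> real) two_tensor" where
  "g_Sigma \<alpha> \<beta> = (\<lambda>(x, y) X Y.
     (1 + 2 * tn_M \<alpha> \<beta> * (tn_k \<alpha> \<beta> * y + sqrt (x\<^sup>2 + y\<^sup>2))) / sqrt (x\<^sup>2 + y\<^sup>2) * (X \<bullet> Y))"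

definition gradient ::
  "'a::euclidean_space two_tensor \<Rightarrow> ('a \<Rightarrow> real) \<Rightarrow> 'a \<Rightarrow> 'a" where
  "gradient g f p = sharp g p (frechet_derivative f (at p))"

definition grad_prod ::
  "real \<Rightarrow> real \<Rightarrow> (real \<times> real \<Rightarrow> real) \<Rightarrow> (real \<times> real \<Rightarrow> real) \<Rightarrow> real \<times> real \<Rightarrow> real" where
  "grad_prod \<alpha> \<beta> f h s =
     g_Sigma \<alpha> \<beta> s (gradient (g_Sigma \<alpha> \<beta>) f s) (gradient (g_Sigma \<alpha> \<beta>) h s)"

text \<open>Points and tangent vectors of \<open>{x > 0} \<times> \<real>\<^sup>2\<close>, the universal cover of \<open>{x > 0} \<times> T\<^sup>2\<close>,
  are written \<open>((x, y), (\<theta>\<^sub>1, \<theta>\<^sub>2))\<close>.\<close>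

type_synonym tn_coord = "(real \<times> real) \<times> (real \<times> real)"

definition tn_coord_dom :: "tn_coord set" where
  "tn_coord_dom = {((x, y), t) | x y t. x > 0}"

definition tn_coord_metric :: "real \<Rightarrow> real \<Rightarrow> tn_coord two_tensor" where
  "tn_coord_metric \<alpha> \<beta> = (\<lambda>(s, t) (X, (a1, a2)) (Y, (b1, b2)).
     g_Sigma \<alpha> \<beta> s X Y
     + grad_prod \<alpha> \<beta> (psi1 \<alpha>) (psi1 \<alpha>) s * a1 * b1
     + grad_prod \<alpha> \<beta> (psi1 \<alpha>) (psi2 \<beta>) s * a1 * b2
     + grad_prod \<alpha> \<beta> (psi2 \<beta>) (psi1 \<alpha>) s * a2 * b1
     + grad_prod \<alpha> \<beta> (psi2 \<beta>) (psi2 \<beta>) s * a2 * b2)"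

definition tn_coord_omega :: "real \<Rightarrow> real \<Rightarrow> tn_coord two_tensor" where
  "tn_coord_omega \<alpha> \<beta> = (\<lambda>(s, t) (X, (a1, a2)) (Y, (b1, b2)).
     frechet_derivative (psi1 \<alpha>) (at s) X * b1 - frechet_derivative (psi1 \<alpha>) (at s) Y * a1
   + frechet_derivative (psi2 \<beta>) (at s) X * b2 - frechet_derivative (psi2 \<beta>) (at s) Y * a2)"

text \<open>\<open>\<omega>(X, Y) = g(J X, Y)\<close>.\<close>

definition tn_coord_J :: "real \<Rightarrow> real \<Rightarrow> tn_coord endo_field" where
  "tn_coord_J \<alpha> \<beta> q X = sharp (tn_coord_metric \<alpha> \<beta>) q (tn_coord_omega \<alpha> \<beta> q X)"

text \<open>The covering of \<open>(\<complex> \<setminus> {0})\<^sup>2\<close> given by \<open>z\<^sub>1 = v e\<^bsup>i \<theta>\<^sub>1 / \<surd>2\<^esup>\<close>, \<open>z\<^sub>2 = u e\<^bsup>i \<theta>\<^sub>2 / \<surd>2\<^esup>\<close>.\<close>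

definition tn_chart :: "real \<Rightarrow> real \<Rightarrow> tn_coord \<Rightarrow> complex \<times> complex" where
  "tn_chart \<alpha> \<beta> = (\<lambda>((x, y), (\<theta>1, \<theta>2)).
     let u = sqrt (tn_M \<alpha> \<beta> * (sqrt (x\<^sup>2 + y\<^sup>2) + y));
         v = sqrt (tn_M \<alpha> \<beta> * (sqrt (x\<^sup>2 + y\<^sup>2) - y))
     in (complex_of_real v * cis (\<theta>1 / sqrt 2), complex_of_real u * cis (\<theta>2 / sqrt 2)))"

abbreviation tn_chart_deriv :: "real \<Rightarrow> real \<Rightarrow> tn_coord \<Rightarrow> tn_coord \<Rightarrow> complex \<times> complex" where
  "tn_chart_deriv \<alpha> \<beta> q \<equiv> frechet_derivative (tn_chart \<alpha> \<beta>) (at q)"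

text \<open>The smooth tensor fields on \<open>\<complex>\<^sup>2\<close> that restrict on the dense subset \<open>(\<complex> \<setminus> {0})\<^sup>2\<close> to
  the structure given in coordinates; density makes them unique.\<close>

definition taub_nut_metric :: "real \<Rightarrow> real \<Rightarrow> (complex \<times> complex) two_tensor" where
  "taub_nut_metric \<alpha> \<beta> = (THE g. smooth_two_tensor UNIV g \<and>
     (\<forall>q\<in>tn_coord_dom. \<forall>X Y.
        g (tn_chart \<alpha> \<beta> q) (tn_chart_deriv \<alpha> \<beta> q X) (tn_chart_deriv \<alpha> \<beta> q Y)
          = tn_coord_metric \<alpha> \<beta> q X Y))"

definition taub_nut_J :: "real \<Rightarrow> real \<Rightarrow> (complex \<times> complex) endo_field" where
  "taub_nut_J \<alpha> \<beta> = (THE J. smooth_endo UNIV J \<and>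
     (\<forall>q\<in>tn_coord_dom. \<forall>X.
        J (tn_chart \<alpha> \<beta> q) (tn_chart_deriv \<alpha> \<beta> q X)
          = tn_chart_deriv \<alpha> \<beta> q (tn_coord_J \<alpha> \<beta> q X)))"

end

theory Submission
  imports Defs
begin

text \<open>
  Exactly one of the two parameters vanishes, and exchanging the two factors of \<open>\<complex>\<^sup>2\<close> (together
  with \<open>y \<mapsto> -y\<close>) exchanges the two cases.  Let \<open>w\<close> be the factor with \<open>\<bar>w\<bar>\<^sup>2 = M (r + k y)\<close>
  and \<open>z\<close> the other one.  Put \<open>F = 1 + 2 \<bar>w\<bar>\<^sup>2\<close> and let \<open>\<mu>\<close> be the complex one-form
  \<open>dw + w (d\<bar>w\<bar>\<^sup>2 + z\<^sup>* dz - z dz\<^sup>*)\<close>.  Polar coordinates turn the given metric and Kaehler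
  form into
  \<open>g = (2/M) (F \<bar>dz\<bar>\<^sup>2 + \<bar>\<mu>\<bar>\<^sup>2 / F)\<close>, with \<open>J\<close> multiplying both \<open>dz\<close> and \<open>\<mu>\<close> by \<open>\<i>\<close>.
  These expressions are smooth on all of \<open>\<complex>\<^sup>2\<close>, so by density they are the extension; this is
  shown in \<open>taub_nut_metric_eq\<close> and \<open>taub_nut_J_eq\<close>.

  All geometry is read off in the coframe \<open>(dz, \<mu>)\<close>, which trivialises the tangent bundle as a
  complex bundle.  There the Levi-Civita connection is \<open>d + om\<close> for an explicit 2 by 2 matrix
  \<open>om\<close> of complex one-forms: it is torsion-free and metric (\<open>gam_sym\<close>, \<open>metric_compatible\<close>), and
  this characterises it (\<open>christoffel_eqI\<close>).  The curvature is the matrix \<open>d om + om \<and> om\<close>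
  (\<open>curvature_frame\<close>).  Its entries are such that \<open>R(X, J X, J X, X)\<close> is a quadratic form in
  \<open>\<bar>dz(X)\<bar>\<^sup>2\<close> and \<open>\<bar>\<mu>(X)\<bar>\<^sup>2\<close> (\<open>curvature_holomorphic\<close>).  With \<open>D\<close> the kernel of \<open>dz\<close>, the number
  \<open>\<bar>\<mu>(X)\<bar>\<^sup>2\<close> is proportional to \<open>\<bar>X\<^sub>D\<bar>\<^sup>2\<close>, and \<open>\<bar>dz(X)\<bar>\<^sup>2\<close> is then fixed by \<open>g(X, X) = 1\<close>.
  Hence \<open>D\<close> makes the surface QCH, on all of \<open>\<complex>\<^sup>2\<close>.

  The opposite structure \<open>I\<close> multiplies \<open>dz\<close> by \<open>-\<i>\<close> and \<open>\<mu>\<close> by \<open>\<i>\<close>.  It is integrable, its Lee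
  form is \<open>dF / F\<close> (\<open>lee_I\<close>), and therefore \<open>F\<^sup>-\<^sup>2 g\<close> is Kaehler for \<open>I\<close> (\<open>conformal_kaehler\<close>).
  The covariant derivative of \<open>I\<close> is the commutator of \<open>om\<close> with \<open>I\<close>, so only the off-diagonal
  entries of \<open>om\<close> matter; they are nonvanishing multiples of \<open>w\<^sup>* dz\<close> and \<open>w dz\<^sup>*\<close>.  Where
  \<open>w \<noteq> 0\<close> this makes \<open>\<nabla>I\<close> nonzero, with \<open>{X. \<nabla>\<^sub>X I = 0} = D\<close>, and \<open>D\<close> is also spanned by the dual of
  \<open>dF\<close> and its image under \<open>I\<close>.  So the open dense set \<open>{w \<noteq> 0}\<close> is of Calabi type.
\<close>

section \<open>Smooth maps on a Euclidean space\<close>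

lemma C_k_on_subset: "C_k_on n f T \<Longrightarrow> S \<subseteq> T \<Longrightarrow> C_k_on n f S"
  by (induction n arbitrary: f) (auto intro: continuous_on_subset)

lemma smooth_on_subset: "smooth_on T f \<Longrightarrow> S \<subseteq> T \<Longrightarrow> smooth_on S f"
  unfolding smooth_on_def using C_k_on_subset by blast

lemma C_k_on_Suc_imp: "C_k_on (Suc n) f S \<Longrightarrow> C_k_on n f S"
proof (induction n arbitrary: f)
  case 0
  then show ?case
    by (auto intro!: continuous_at_imp_continuous_on differentiable_imp_continuous_within)
next
  case (Suc n)
  show ?case
    unfolding C_k_on.simps(2)[of n]
  proof (intro conjI allI)
    show "\<forall>p\<in>S. f differentiable at p" using Suc.prems by simp
    fix X
    have "C_k_on (Suc n) (\<lambda>p. frechet_derivative f (at p) X) S"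
      using Suc.prems unfolding C_k_on.simps(2)[of "Suc n"] by blast
    then show "C_k_on n (\<lambda>p. frechet_derivative f (at p) X) S" by (rule Suc.IH)
  qed
qed

text \<open>On the whole space a derivative can be replaced by any expression that equals it everywhere.  So
  the closure properties follow by induction on the order: the differentiation rule
  expresses the derivative of a compound by compounds of lower order.\<close>

lemma C_k_on_Suc_UNIV_I:
  assumes "\<And>p. (f has_derivative f' p) (at p)" and "\<And>X. C_k_on n (\<lambda>p. f' p X) UNIV"
  shows "C_k_on (Suc n) f UNIV"
proof -
  have "frechet_derivative f (at p) = f' p" for p
    using assms(1) frechet_derivative_at by metis
  then show ?thesis
    using assms by (auto simp: differentiable_def)
qed

lemma C_k_on_Suc_UNIV_D:
  assumes "C_k_on (Suc n) f UNIV"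
  shows "(f has_derivative frechet_derivative f (at p)) (at p)"
    and "C_k_on n (\<lambda>p. frechet_derivative f (at p) X) UNIV"
  using assms by (auto simp: frechet_derivative_works)

lemma C_k_on_const: "C_k_on n (\<lambda>p. a) UNIV"
proof (induction n arbitrary: a)
  case (Suc n)
  show ?case by (rule C_k_on_Suc_UNIV_I[where f' = "\<lambda>p X. 0"]) (auto intro: Suc)
qed (simp add: continuous_on_const)

lemma C_k_on_bounded_linear:
  assumes "bounded_linear L"
  shows "C_k_on n f UNIV \<Longrightarrow> C_k_on n (\<lambda>p. L (f p)) UNIV"
proof (induction n arbitrary: f)
  case 0
  then show ?case using assms by (simp add: bounded_linear.continuous_on)
next
  case (Suc n)
  show ?case
    by (rule C_k_on_Suc_UNIV_I[OF bounded_linear.has_derivative[OF assms C_k_on_Suc_UNIV_D(1)[OF Suc.prems]]])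
       (rule Suc.IH[OF C_k_on_Suc_UNIV_D(2)[OF Suc.prems]])
qed

lemma C_k_on_add:
  "C_k_on n f UNIV \<Longrightarrow> C_k_on n h UNIV \<Longrightarrow> C_k_on n (\<lambda>p. f p + h p) UNIV"
proof (induction n arbitrary: f h)
  case 0
  then show ?case by (simp add: continuous_on_add)
next
  case (Suc n)
  show ?case
    by (rule C_k_on_Suc_UNIV_I[OF has_derivative_add[OF C_k_on_Suc_UNIV_D(1)[OF Suc.prems(1)]
             C_k_on_Suc_UNIV_D(1)[OF Suc.prems(2)]]])
       (rule Suc.IH[OF C_k_on_Suc_UNIV_D(2)[OF Suc.prems(1)] C_k_on_Suc_UNIV_D(2)[OF Suc.prems(2)]])
qed

lemma C_k_on_bounded_bilinear:
  assumes "bounded_bilinear B"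
  shows "C_k_on n f UNIV \<Longrightarrow> C_k_on n h UNIV \<Longrightarrow> C_k_on n (\<lambda>p. B (f p) (h p)) UNIV"
proof (induction n arbitrary: f h)
  case 0
  then show ?case using assms by (simp add: bounded_bilinear.continuous_on)
next
  case (Suc n)
  show ?case
  proof (rule C_k_on_Suc_UNIV_I[OF bounded_bilinear.FDERIV[OF assms C_k_on_Suc_UNIV_D(1)[OF Suc.prems(1)]
             C_k_on_Suc_UNIV_D(1)[OF Suc.prems(2)]]])
    fix X
    show "C_k_on n (\<lambda>p. B (f p) (frechet_derivative h (at p) X)
        + B (frechet_derivative f (at p) X) (h p)) UNIV"
      by (intro C_k_on_add Suc.IH C_k_on_Suc_UNIV_D(2) C_k_on_Suc_imp[OF Suc.prems(1)]
            C_k_on_Suc_imp[OF Suc.prems(2)] Suc.prems)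
  qed
qed

lemma smooth_on_const: "smooth_on UNIV (\<lambda>p. a)"
  by (simp add: smooth_on_def C_k_on_const)

lemma smooth_on_compose_linear:
  "bounded_linear L \<Longrightarrow> smooth_on UNIV f \<Longrightarrow> smooth_on UNIV (\<lambda>p. L (f p))"
  by (simp add: smooth_on_def C_k_on_bounded_linear)

lemma smooth_on_linear:
  assumes "bounded_linear L"
  shows "smooth_on UNIV L"
  unfolding smooth_on_def
proof
  fix n
  show "C_k_on n L UNIV"
  proof (cases n)
    case 0
    then show ?thesis using assms by (simp add: linear_continuous_on)
  next
    case (Suc n)
    show ?thesis
      unfolding Suc
      by (rule C_k_on_Suc_UNIV_I[OF bounded_linear_imp_has_derivative[OF assms]]) (rule C_k_on_const)
  qed
qed

lemma smooth_on_add: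
  "smooth_on UNIV f \<Longrightarrow> smooth_on UNIV h \<Longrightarrow> smooth_on UNIV (\<lambda>p. f p + h p)"
  by (simp add: smooth_on_def C_k_on_add)

lemma smooth_on_mult:
  fixes f h :: "'a::euclidean_space \<Rightarrow> 'b::real_normed_algebra"
  shows "smooth_on UNIV f \<Longrightarrow> smooth_on UNIV h \<Longrightarrow> smooth_on UNIV (\<lambda>p. f p * h p)"
  by (simp add: smooth_on_def C_k_on_bounded_bilinear[OF bounded_bilinear_mult])

lemma smooth_on_uminus:
  "smooth_on UNIV f \<Longrightarrow> smooth_on UNIV (\<lambda>p. - f p)"
  by (rule smooth_on_compose_linear[OF bounded_linear_minus[OF bounded_linear_ident]])

lemma smooth_on_diff:
  "smooth_on UNIV f \<Longrightarrow> smooth_on UNIV h \<Longrightarrow> smooth_on UNIV (\<lambda>p. f p - h p)"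
  using smooth_on_add[of f "\<lambda>p. - h p"] smooth_on_uminus[of h] by simp

lemma smooth_on_power:
  fixes f :: "'a::euclidean_space \<Rightarrow> 'b::real_normed_algebra_1"
  shows "smooth_on UNIV f \<Longrightarrow> smooth_on UNIV (\<lambda>p. f p ^ n)"
  by (induction n) (simp_all add: smooth_on_const smooth_on_mult)

lemma smooth_on_inverse:
  fixes f :: "'a::euclidean_space \<Rightarrow> 'b::real_normed_field"
  assumes f: "smooth_on UNIV f" and nz: "\<And>p. f p \<noteq> 0"
  shows "smooth_on UNIV (\<lambda>p. inverse (f p))"
  unfolding smooth_on_def
proof
  fix n
  note mult = C_k_on_bounded_bilinear[OF bounded_bilinear_mult]
  show "C_k_on n (\<lambda>p. inverse (f p)) UNIV"
  proof (induction n)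
    case 0
    have "continuous_on UNIV f" using f unfolding smooth_on_def by (metis C_k_on.simps(1))
    then show ?case using nz by (simp add: continuous_on_inverse)
  next
    case (Suc n)
    have fS: "C_k_on (Suc n) f UNIV" using f by (simp only: smooth_on_def)
    show ?case
    proof (rule C_k_on_Suc_UNIV_I[OF Deriv.has_derivative_inverse[OF nz C_k_on_Suc_UNIV_D(1)[OF fS]]])
      fix X
      show "C_k_on n (\<lambda>p. - (inverse (f p) * frechet_derivative f (at p) X * inverse (f p))) UNIV"
        by (rule C_k_on_bounded_linear[OF bounded_linear_minus[OF bounded_linear_ident]])
           (intro mult Suc.IH C_k_on_Suc_UNIV_D(2)[OF fS])
    qed
  qed
qed

lemma smooth_on_ln:
  fixes f :: "'a::euclidean_space \<Rightarrow> real"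
  assumes f: "smooth_on UNIV f" and pos: "\<And>p. f p > 0"
  shows "smooth_on UNIV (\<lambda>p. ln (f p))"
  unfolding smooth_on_def
proof
  fix n
  have nz: "f p \<noteq> 0" for p using pos[of p] by simp
  have fk: "C_k_on n f UNIV" for n using f by (simp only: smooth_on_def)
  show "C_k_on n (\<lambda>p. ln (f p)) UNIV"
  proof (cases n)
    case 0
    have "continuous_on UNIV f" using fk[of 0] by simp
    then show ?thesis using nz 0 by (simp add: continuous_on_ln)
  next
    case (Suc n)
    have "((\<lambda>p. ln (f p)) has_derivative (\<lambda>X. frechet_derivative f (at p) X * inverse (f p))) (at p)" for p
      using DERIV_compose_FDERIV[where g = f, OF DERIV_ln[OF pos[of p]] C_k_on_Suc_UNIV_D(1)[OF fk[of "Suc n"]]] .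
    then show ?thesis
      unfolding Suc
    proof (rule C_k_on_Suc_UNIV_I)
      show "C_k_on n (\<lambda>p. frechet_derivative f (at p) X * inverse (f p)) UNIV" for X
        using smooth_on_inverse[OF f nz] C_k_on_Suc_UNIV_D(2)[OF fk[of "Suc n"]]
        by (intro C_k_on_bounded_bilinear[OF bounded_bilinear_mult]) (auto simp: smooth_on_def)
    qed
  qed
qed

lemma smooth_on_continuous: "smooth_on S f \<Longrightarrow> continuous_on S f"
  unfolding smooth_on_def by (metis C_k_on.simps(1))

lemma smooth_on_differentiable: "smooth_on UNIV f \<Longrightarrow> f differentiable (at p)"
  unfolding smooth_on_def using C_k_on.simps(2) by (metis UNIV_I)

lemmas smooth_intros = smooth_on_const smooth_on_add smooth_on_diff smooth_on_mult smooth_on_uminus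
  smooth_on_power

section \<open>Levi-Civita connections from their defining properties\<close>

lemma sharp_eqI:
  assumes bil: "bilinear (g p)" and pos: "\<And>X. X \<noteq> 0 \<Longrightarrow> g p X X > 0"
    and Z: "\<And>W. g p Z W = \<phi> W"
  shows "sharp g p \<phi> = Z"
  unfolding sharp_def
proof (rule the_equality)
  show "\<forall>W. g p Z W = \<phi> W" using Z by blast
  fix Y assume Y: "\<forall>W. g p Y W = \<phi> W"
  have "g p (Y - Z) (Y - Z) = 0"
    using Y Z by (simp add: bilinear_lsub[OF bil])
  then show "Y = Z" using pos[of "Y - Z"] by force
qed

text \<open>Koszul's argument: a symmetric connection that is compatible with the metric is recovered
  from the derivatives of the metric by summing the compatibility equations cyclically.\<close>

lemma christoffel_eqI:
  assumes bil: "bilinear (g p)" and pos: "\<And>X. X \<noteq> 0 \<Longrightarrow> g p X X > 0"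
    and comm: "\<And>X Y. g p X Y = g p Y X"
    and torsion: "\<And>X Y. \<Gamma> X Y = \<Gamma> Y X"
    and metric: "\<And>X Y W. frechet_derivative (\<lambda>q. g q Y W) (at p) X = g p (\<Gamma> X Y) W + g p Y (\<Gamma> X W)"
  shows "christoffel g p X Y = \<Gamma> X Y"
  unfolding christoffel_def
proof (rule sharp_eqI)
  fix W
  show "g p (\<Gamma> X Y) W = (frechet_derivative (\<lambda>q. g q Y W) (at p) X
    + frechet_derivative (\<lambda>q. g q X W) (at p) Y - frechet_derivative (\<lambda>q. g q X Y) (at p) W) / 2"
    unfolding metric using torsion[of X W] torsion[of Y W] torsion[of X Y]
      comm[of Y "\<Gamma> W X"] comm[of X "\<Gamma> W Y"] by simp
qed (use bil pos in auto)

section \<open>A Hermitian coframe on complex 2-space\<close>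

text \<open>The coordinates \<open>z\<close> and \<open>w\<close> are the two projections of \<open>\<complex>\<^sup>2\<close>, in either order; they serve
  both as coordinates of points and, being linear, as the coframe \<open>dz, dw\<close>.  The maps
  \<open>(z, w) \<mapsto> (z + z\<^sub>0, e\<^bsup>i f(z)\<^esup> w)\<close>, with \<open>f\<close> the real affine function that compensates the
  change of \<open>z\<^sup>* dz - z dz\<^sup>*\<close>, preserve the structure below; they form a quotient of the
  Heisenberg group.\<close>

locale heisenberg_frame =
  fixes z w :: "'a::euclidean_space \<Rightarrow> complex" and vec :: "complex \<Rightarrow> complex \<Rightarrow> 'a" and s :: real
  assumes bl_z: "bounded_linear z" and bl_w: "bounded_linear w"
    and z_vec [simp]: "z (vec a b) = a" and w_vec [simp]: "w (vec a b) = b"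
    and vec_zw [simp]: "vec (z x) (w x) = x"
    and s_pos: "s > 0"
begin

lemma eqI: "z X = z Y \<Longrightarrow> w X = w Y \<Longrightarrow> X = Y"
  by (metis vec_zw)

lemma vec_eq: "vec a b = X \<longleftrightarrow> a = z X \<and> b = w X"
  by auto

lemma zw_linear [simp]:
  "z 0 = 0" "w 0 = 0" "z (x + y) = z x + z y" "w (x + y) = w x + w y"
  "z (x - y) = z x - z y" "w (x - y) = w x - w y" "z (- x) = - z x" "w (- x) = - w x"
  "z (r *\<^sub>R x) = r *\<^sub>R z x" "w (r *\<^sub>R x) = r *\<^sub>R w x"
  by (simp_all add: bl_z bl_w bounded_linear.linear linear_0 linear_add linear_diff linear_neg
      linear_scale)

lemma z_der: "(z has_derivative z) (at p)"
  and w_der: "(w has_derivative w) (at p)"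
  using bl_z bl_w by (simp_all add: bounded_linear_imp_has_derivative)

lemma bl_vec: "bounded_linear (\<lambda>(a, b). vec a b)"
proof -
  have "linear (\<lambda>(a, b). vec a b)"
    by (intro linearI; rule eqI; clarsimp)
  then show ?thesis by (rule linear_conv_bounded_linear[THEN iffD1])
qed

lemma dim4: "DIM('a) = 4"
proof -
  have "linear (\<lambda>(a, b). vec a b)" using bl_vec by (rule bounded_linear.linear)
  moreover have "inj (\<lambda>(a, b). vec a b)" by (auto intro!: injI simp: vec_eq)
  ultimately have "dim (range (\<lambda>(a, b). vec a b)) = dim (UNIV :: (complex \<times> complex) set)"
    by (intro dim_image_eq) simp_all
  moreover have "x \<in> range (\<lambda>(a, b). vec a b)" for x
    by (rule range_eqI[where x = "(z x, w x)"]) simp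
  then have "range (\<lambda>(a, b). vec a b) = UNIV" by blast
  ultimately show ?thesis by simp
qed

lemma vec_der:
  assumes "(a has_derivative a') (at p)" and "(b has_derivative b') (at p)"
  shows "((\<lambda>q. vec (a q) (b q)) has_derivative (\<lambda>X. vec (a' X) (b' X))) (at p)"
  using bounded_linear.has_derivative[OF bl_vec has_derivative_Pair[OF assms]] by simp

text \<open>The real part is \<open>d\<bar>w\<bar>\<^sup>2\<close>; the imaginary part is the connection form of the line bundle over the
  \<open>z\<close>-plane.  Real bilinearity in the point and the vector means that differentiating at the point
  just inserts the direction.\<close>

definition conn :: "'a \<Rightarrow> 'a \<Rightarrow> complex" where
  "conn p X = cnj (w p) * w X + w p * cnj (w X) + cnj (z p) * z X - z p * cnj (z X)"

text \<open>Wherever \<open>w \<noteq> 0\<close>, the quotient \<open>\<mu> / w\<close> is \<open>F du / u + \<i> (d\<phi> + \<tau>)\<close> for \<open>w = u e\<^bsup>i\<phi>\<^esup>\<close> and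
  \<open>\<i> \<tau> = z\<^sup>* dz - z dz\<^sup>*\<close>, a form of type (1,0).  The factor \<open>w\<close> removes its pole.\<close>

definition mu :: "'a \<Rightarrow> 'a \<Rightarrow> complex" where
  "mu p X = w X + w p * conn p X"

definition dmu :: "'a \<Rightarrow> 'a \<Rightarrow> 'a \<Rightarrow> complex" where
  "dmu p X Y = w X * conn p Y + w p * conn X Y"

text \<open>The number \<open>1 / F\<close> as a complex one: identities below are then polynomial identities in complex
  quantities and their conjugates, modulo \<open>m_F\<close>.\<close>

definition m :: "'a \<Rightarrow> complex" where
  "m p = inverse (1 + 2 * w p * cnj (w p))"

definition F :: "'a \<Rightarrow> real" where
  "F p = 1 + 2 * (cmod (w p))\<^sup>2"

lemma F_pos [simp]: "F p > 0"
  unfolding F_def by (meson add_pos_nonneg mult_nonneg_nonneg zero_le_numeral zero_le_power2 zero_less_one)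

lemma F_nz [simp]: "F p \<noteq> 0"
  by (metis F_pos less_irrefl)

lemma of_real_F: "complex_of_real (F p) = 1 + 2 * w p * cnj (w p)"
  by (simp add: F_def complex_norm_square[symmetric] mult.assoc)

lemma m_eq: "m p = complex_of_real (1 / F p)"
  by (simp add: m_def of_real_F[symmetric] inverse_eq_divide)

lemma m_nz [simp]: "m p \<noteq> 0"
  by (simp add: m_eq)

lemma cnj_m [simp]: "cnj (m p) = m p"
  by (simp add: m_eq)

lemma m_F: "m p * (1 + 2 * w p * cnj (w p)) = 1"
  using m_nz[of p] unfolding m_def by (metis left_inverse inverse_nonzero_iff_nonzero)

lemma zw_der_intros:
  assumes "(f has_derivative f') (at p)"
  shows "((\<lambda>q. z (f q)) has_derivative (\<lambda>X. z (f' X))) (at p)"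
    and "((\<lambda>q. w (f q)) has_derivative (\<lambda>X. w (f' X))) (at p)"
  using assms bl_z bl_w by (auto intro: bounded_linear.has_derivative)

lemma conn_linear [simp]: "conn p (X + Y) = conn p X + conn p Y" "conn p (r *\<^sub>R X) = r *\<^sub>R conn p X"
  "conn (p + q) X = conn p X + conn q X" "conn (r *\<^sub>R p) X = r *\<^sub>R conn p X"
  "conn p (X - Y) = conn p X - conn p Y" "conn p (- X) = - conn p X" "conn p 0 = 0"
  by (simp_all add: conn_def algebra_simps scaleR_conv_of_real)

lemma mu_linear [simp]: "mu p (X + Y) = mu p X + mu p Y" "mu p (r *\<^sub>R X) = r *\<^sub>R mu p X"
  "mu p (X - Y) = mu p X - mu p Y" "mu p (- X) = - mu p X" "mu p 0 = 0"
  by (simp_all add: mu_def algebra_simps)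

lemma bl_conn: "bounded_linear (\<lambda>p. conn p X)"
  by (intro linear_conv_bounded_linear[THEN iffD1] linearI) auto

lemma conn_der: "((\<lambda>q. conn q Y) has_derivative (\<lambda>X. conn X Y)) (at p)"
  using bl_conn by (rule bounded_linear_imp_has_derivative)

lemma mu_der: "((\<lambda>q. mu q Y) has_derivative (\<lambda>X. dmu p X Y)) (at p)"
  unfolding mu_def dmu_def
  by (auto intro!: derivative_eq_intros conn_der w_der simp: algebra_simps)

lemma dmu_der:
  "((\<lambda>q. dmu q Y Z) has_derivative (\<lambda>X. w Y * conn X Z + w X * conn Y Z)) (at p)"
  unfolding dmu_def by (auto intro!: derivative_eq_intros conn_der w_der)

lemma m_der: "(m has_derivative (\<lambda>X. - 2 * (m p)\<^sup>2 * (cnj (w p) * w X + w p * cnj (w X)))) (at p)"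
proof -
  have "1 + 2 * w p * cnj (w p) \<noteq> 0"
    using m_nz[of p] unfolding m_def by auto
  then show ?thesis
    unfolding m_def
    by (auto intro!: derivative_eq_intros w_der has_derivative_cnj simp: power2_eq_square algebra_simps)
qed

text \<open>The inverse of \<open>(dz, \<mu>)\<close> at a point.  From \<open>b = \<mu>(X)\<close> one gets \<open>d\<bar>w\<bar>\<^sup>2(X) = (w\<^sup>* b + w b\<^sup>*) / F\<close>,
  which determines \<open>dw(X)\<close>.\<close>

definition Psi :: "'a \<Rightarrow> complex \<Rightarrow> complex \<Rightarrow> 'a" where
  "Psi p a b = vec a (b - w p * (cnj (z p) * a - z p * cnj a + m p * (cnj (w p) * b + w p * cnj b)))"

lemma z_Psi [simp]: "z (Psi p a b) = a"
  by (simp add: Psi_def)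

lemma mu_Psi [simp]: "mu p (Psi p a b) = b"
proof -
  let ?u = "w p" and ?z = "z p" and ?m = "m p"
  have "conn p (Psi p a b) = (cnj ?z * a - ?z * cnj a)
      + (cnj ?u * b + ?u * cnj b) * (1 - ?m * (2 * ?u * cnj ?u))"
    by (simp add: conn_def Psi_def algebra_simps)
  also have "1 - ?m * (2 * ?u * cnj ?u) = ?m"
    using m_F[of p] by (simp add: algebra_simps)
  finally have c: "conn p (Psi p a b) = (cnj ?z * a - ?z * cnj a) + (cnj ?u * b + ?u * cnj b) * ?m" .
  have "w (Psi p a b) = b - ?u * (cnj ?z * a - ?z * cnj a + ?m * (cnj ?u * b + ?u * cnj b))"
    by (simp add: Psi_def)
  then show ?thesis
    unfolding mu_def c by (simp add: algebra_simps)
qed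

lemma frame_eqI:
  assumes "z X = z Y" and "mu p X = mu p Y"
  shows "X = Y"
proof -
  have "Psi p (z X) (mu p X) = X" for X
  proof (rule eqI)
    have "mu p (Psi p (z X) (mu p X) - X) = 0" and zz: "z (Psi p (z X) (mu p X) - X) = 0" by simp_all
    then have *: "d + w p * (cnj (w p) * d + w p * cnj d) = 0"
      if "d = w (Psi p (z X) (mu p X) - X)" for d
      using that by (simp add: mu_def conn_def)
    \<comment> \<open>The defect \<open>d\<close> is a real multiple \<open>- e\<close> of \<open>w p\<close>, and then \<open>e = - 2 \<bar>w\<bar>\<^sup>2 e\<close> forces \<open>e = 0\<close>.\<close>
    define d where "d = w (Psi p (z X) (mu p X) - X)"
    define e where "e = cnj (w p) * d + w p * cnj d"
    have d: "d = - w p * e" using *[OF d_def] unfolding e_def by (simp add: eq_neg_iff_add_eq_0)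
    have "cnj e = e" unfolding e_def by (simp add: add.commute)
    have "e = - (e * (2 * w p * cnj (w p)))"
      using e_def \<open>cnj e = e\<close> unfolding d by (simp add: algebra_simps)
    then have "e * (1 + 2 * w p * cnj (w p)) = 0"
      by (simp add: eq_neg_iff_add_eq_0 distrib_left)
    then have "e = 0" using m_F[of p] by auto
    then show "w (Psi p (z X) (mu p X)) = w X" using d d_def by simp
  qed simp
  then show ?thesis using assms by metis
qed

lemma Psi_frame [simp]: "Psi p (z X) (mu p X) = X"
  by (rule frame_eqI[where p = p]) simp_all

section \<open>The metric\<close>

definition g :: "'a two_tensor" where
  "g p X Y = s * Re ((1 + 2 * w p * cnj (w p)) * (cnj (z X) * z Y) + m p * (cnj (mu p X) * mu p Y))"

lemma g_eq: "g p X Y = s * (F p * Re (cnj (z X) * z Y) + Re (cnj (mu p X) * mu p Y) / F p)"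
proof -
  have "Re (complex_of_real r * x) = r * Re x" for r x by simp
  then show ?thesis
    unfolding g_def of_real_F[symmetric] m_eq plus_complex.sel by simp
qed

lemma g_pos:
  assumes "X \<noteq> 0" shows "g p X X > 0"
proof -
  have eq: "g p X X = s * (F p * (cmod (z X))\<^sup>2 + (cmod (mu p X))\<^sup>2 / F p)"
    unfolding g_eq cmod_power2 by (simp add: power2_eq_square)
  have "z X \<noteq> 0 \<or> mu p X \<noteq> 0" using assms frame_eqI[of X 0 p] by auto
  then have "F p * (cmod (z X))\<^sup>2 + (cmod (mu p X))\<^sup>2 / F p > 0"
    using F_pos[of p] less_imp_le[OF F_pos[of p]]
    by (elim disjE) (simp_all add: add_pos_nonneg add_nonneg_pos)
  then show ?thesis using s_pos eq by simp
qed

lemma g_comm: "g p X Y = g p Y X"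
  by (simp add: g_eq algebra_simps)

lemma bilinear_g: "bilinear (g p)"
  unfolding bilinear_def g_eq
  by (auto intro!: linearI simp: algebra_simps add_divide_distrib)

lemma linear_smooth: "smooth_on UNIV z" "smooth_on UNIV w" "smooth_on UNIV (\<lambda>q. cnj (w q))"
  "smooth_on UNIV (\<lambda>q. cnj (z q))"
  using bl_z bl_w smooth_on_linear smooth_on_compose_linear[OF bounded_linear_cnj] by auto

lemma smooth_conn: "smooth_on UNIV (\<lambda>q. conn q X)"
  using bl_conn by (rule smooth_on_linear)

lemma smooth_mu: "smooth_on UNIV (\<lambda>q. mu q X)"
  unfolding mu_def by (intro smooth_intros smooth_conn linear_smooth)

lemma smooth_m: "smooth_on UNIV m"
  unfolding m_def using m_nz
  by (intro smooth_on_inverse smooth_intros linear_smooth) (auto simp: m_def)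

lemma smooth_g: "smooth_on UNIV (\<lambda>p. g p X Y)"
  unfolding g_def
  by (intro smooth_on_compose_linear[OF bounded_linear_Re] smooth_intros smooth_mu smooth_m linear_smooth
       smooth_on_compose_linear[OF bounded_linear_cnj])

lemma smooth_Psi:
  assumes a: "smooth_on UNIV a" and b: "smooth_on UNIV b"
  shows "smooth_on UNIV (\<lambda>p. Psi p (a p) (b p))"
proof -
  have vec: "smooth_on UNIV (\<lambda>p. vec (a' p) (b' p))"
    if "smooth_on UNIV a'" "smooth_on UNIV b'" for a' b'
  proof -
    have "linear (\<lambda>a. vec a 0)" "linear (\<lambda>b. vec 0 b)"
      by (rule linearI; rule eqI; simp only: z_vec w_vec zw_linear add_0_left scaleR_zero_right)+
    then have "bounded_linear (\<lambda>a. vec a 0)" "bounded_linear (\<lambda>b. vec 0 b)"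
      by (simp_all only: linear_conv_bounded_linear)
    then have "smooth_on UNIV (\<lambda>p. vec (a' p) 0 + vec 0 (b' p))"
      using smooth_on_add[OF smooth_on_compose_linear[where f = a'] smooth_on_compose_linear[where f = b']]
        that by blast
    moreover have "vec a 0 + vec 0 b = vec a b" for a b by (rule eqI) simp_all
    ultimately show ?thesis by simp
  qed
  show ?thesis
    unfolding Psi_def
    by (intro vec smooth_intros a b smooth_m linear_smooth smooth_on_compose_linear[OF bounded_linear_cnj])
qed

lemma riemannian: "riemannian_metric S g"
  unfolding riemannian_metric_def smooth_two_tensor_def
  using bilinear_g smooth_g smooth_on_subset g_comm g_pos by blast

section \<open>The Levi-Civita connection\<close>

definition dnorm :: "'a \<Rightarrow> 'a \<Rightarrow> complex" where
  "dnorm p X = cnj (w p) * w X + w p * cnj (w X)"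

definition tau :: "'a \<Rightarrow> 'a \<Rightarrow> complex" where
  "tau p X = cnj (z p) * z X - z p * cnj (z X)"

lemma cnj_dnorm [simp]: "cnj (dnorm p X) = dnorm p X" and cnj_tau [simp]: "cnj (tau p X) = - tau p X"
  by (simp_all add: dnorm_def tau_def)

lemma conn_eq: "conn p X = dnorm p X + tau p X"
  by (simp add: dnorm_def tau_def conn_def)

text \<open>With the next lemma this expresses everything in the coframe.  The imaginary part of the
  connection does not contribute to the real part of \<open>w\<^sup>* \<mu>\<close>, and the real part of the connection
  contributes the factor \<open>F\<close>.\<close>

lemma dnorm_eq: "dnorm p X = m p * (cnj (w p) * mu p X + w p * cnj (mu p X))"
proof -
  have "cnj (w p) * mu p X + w p * cnj (mu p X) = (1 + 2 * w p * cnj (w p)) * dnorm p X"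
    unfolding mu_def conn_eq by (simp add: dnorm_def algebra_simps)
  then show ?thesis using m_F[of p] by (metis mult.assoc mult_1)
qed

lemma w_eq: "w X = mu p X - w p * (m p * (cnj (w p) * mu p X + w p * cnj (mu p X)) + tau p X)"
  unfolding dnorm_eq[symmetric] unfolding mu_def conn_eq by simp

text \<open>Dividing by \<open>F\<close> shows that the contribution of \<open>\<mu>\<close> to the Kaehler form is polynomial.\<close>

lemma wedge_mu:
  "cnj (mu p X) * mu p Y - cnj (mu p Y) * mu p X = (1 + 2 * w p * cnj (w p)) *
     (cnj (w X) * w Y - cnj (w Y) * w X + dnorm p X * tau p Y - dnorm p Y * tau p X)"
  unfolding mu_def conn_eq complex_cnj_add complex_cnj_mult cnj_dnorm cnj_tau
  by (simp add: dnorm_def algebra_simps)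

text \<open>The connection matrix.  Over the open set \<open>w \<noteq> 0\<close> it comes from three facts: the fibres of \<open>z\<close>
  are totally geodesic surfaces of revolution, the horizontal spaces have second fundamental form
  given by \<open>dF\<close> and by the curvature of the connection form, and \<open>J\<close> is parallel.
  Dividing the vertical frame field by \<open>w\<close> makes all entries smooth on \<open>\<complex>\<^sup>2\<close>.\<close>

definition om11 :: "'a \<Rightarrow> 'a \<Rightarrow> complex" where
  "om11 p X = 2 * (m p)\<^sup>2 * cnj (w p) * mu p X"

definition om12 :: "'a \<Rightarrow> 'a \<Rightarrow> complex" where
  "om12 p X = 2 * (m p)\<^sup>2 * cnj (w p) * z X"

definition om21 :: "'a \<Rightarrow> 'a \<Rightarrow> complex" where
  "om21 p X = - 2 * w p * cnj (z X)"

definition om22 :: "'a \<Rightarrow> 'a \<Rightarrow> complex" where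
  "om22 p X = tau p X + m p * (w p * cnj (mu p X) - cnj (w p) * mu p X) - 2 * (m p)\<^sup>2 * cnj (w p) * mu p X"

lemmas om_defs = om11_def om12_def om21_def om22_def

text \<open>The first structure equation \<open>d\<mu> = - om \<and> (dz, \<mu>)\<close>, that is, vanishing torsion.\<close>

lemma dmu_antisym:
  "dmu p X Y - dmu p Y X = - (om21 p X * z Y + om22 p X * mu p Y - om21 p Y * z X - om22 p Y * mu p X)"
proof -
  have "m p * (w p * (cnj (mu p X) * mu p Y - cnj (mu p Y) * mu p X)) =
     w p * (cnj (w X) * w Y - cnj (w Y) * w X + dnorm p X * tau p Y - dnorm p Y * tau p X) "
    unfolding wedge_mu using m_F[of p] by (simp add: mult.left_commute mult.assoc[symmetric])
  then have "om22 p X * mu p Y - om22 p Y * mu p X = tau p X * mu p Y - tau p Y * mu p X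
     + w p * (cnj (w X) * w Y - cnj (w Y) * w X + dnorm p X * tau p Y - dnorm p Y * tau p X)"
    unfolding om22_def by (simp add: algebra_simps)
  then show ?thesis
    unfolding dmu_def om21_def mu_def conn_eq
    by (simp add: dnorm_def tau_def conn_def algebra_simps)
qed

text \<open>The Christoffel symbol of the connection \<open>d + om\<close>: the constant field \<open>Y\<close> has frame components
  \<open>(z Y, mu p Y)\<close>, whose derivatives along \<open>X\<close> are \<open>0\<close> and \<open>dmu p X Y\<close>.\<close>

definition gam :: "'a \<Rightarrow> 'a \<Rightarrow> 'a \<Rightarrow> 'a" where
  "gam p X Y = Psi p (om11 p X * z Y + om12 p X * mu p Y)
      (dmu p X Y + (om21 p X * z Y + om22 p X * mu p Y))"

lemma gam_sym: "gam p X Y = gam p Y X"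
proof -
  have "om11 p X * z Y + om12 p X * mu p Y = om11 p Y * z X + om12 p Y * mu p X"
    by (simp add: om_defs)
  moreover have "dmu p X Y + (om21 p X * z Y + om22 p X * mu p Y)
      = dmu p Y X + (om21 p Y * z X + om22 p Y * mu p X)"
    using dmu_antisym[of p X Y] by (simp add: algebra_simps)
  ultimately show ?thesis unfolding gam_def by simp
qed

lemma g_der:
  "((\<lambda>q. g q Y W) has_derivative (\<lambda>X. s * Re (2 * dnorm p X * (cnj (z Y) * z W)
     - 2 * (m p)\<^sup>2 * dnorm p X * (cnj (mu p Y) * mu p W)
     + m p * (cnj (dmu p X Y) * mu p W + cnj (mu p Y) * dmu p X W)))) (at p)"
  unfolding g_def
  by (rule has_derivative_eq_rhs,
      rule has_derivative_mult_right, rule has_derivative_Re,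
      (rule derivative_intros mu_der m_der w_der)+)
     (auto simp: dnorm_def algebra_simps)

text \<open>The terms with \<open>dmu\<close> agree on both sides.  What remains says that \<open>om\<close> is skew-Hermitian up to
  the derivatives of the weights \<open>F\<close> and \<open>1 / F\<close>: the off-diagonal entries cancel because
  \<open>F om12(X) = 2 m w\<^sup>* z(X)\<close> is the negative conjugate of \<open>m om21(X)\<close>.\<close>

lemma metric_compatible:
  "frechet_derivative (\<lambda>q. g q Y W) (at p) X = g p (gam p X Y) W + g p Y (gam p X W)"
proof -
  let ?F = "1 + 2 * w p * cnj (w p)"
  have F': "?F * (2 * (m p)\<^sup>2 * x) = 2 * m p * x" for x
  proof -
    have "?F * (2 * (m p)\<^sup>2 * x) = (m p * ?F) * (2 * m p * x)"
      by (simp only: power2_eq_square ac_simps)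
    then show ?thesis by (simp only: m_F mult_1)
  qed
  have *: "2 * dnorm p X * (cnj (z Y) * z W) - 2 * (m p)\<^sup>2 * dnorm p X * (cnj (mu p Y) * mu p W)
     + m p * (cnj (dmu p X Y) * mu p W + cnj (mu p Y) * dmu p X W)
   = (?F * (cnj (om11 p X * z Y + om12 p X * mu p Y) * z W)
       + m p * (cnj (dmu p X Y + (om21 p X * z Y + om22 p X * mu p Y)) * mu p W))
   + (?F * (cnj (z Y) * (om11 p X * z W + om12 p X * mu p W))
       + m p * (cnj (mu p Y) * (dmu p X W + (om21 p X * z W + om22 p X * mu p W))))" (is "?l = ?r")
  proof -
    have "?F * (cnj (om11 p X * z Y + om12 p X * mu p Y) * z W) =
        2 * m p * ((w p * cnj (mu p X) * cnj (z Y) + w p * cnj (z X) * cnj (mu p Y)) * z W)"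
      unfolding F'[symmetric] by (simp add: om_defs algebra_simps)
    moreover have "?F * (cnj (z Y) * (om11 p X * z W + om12 p X * mu p W)) =
        2 * m p * (cnj (z Y) * (cnj (w p) * mu p X * z W + cnj (w p) * z X * mu p W))"
      unfolding F'[symmetric] by (simp add: om_defs algebra_simps)
    ultimately show ?thesis
      unfolding dnorm_eq om21_def om22_def by (simp add: algebra_simps power2_eq_square)
  qed
  show ?thesis
    unfolding frechet_derivative_at[OF g_der, symmetric] *
    by (simp add: gam_def g_def distrib_left)
qed

lemma christoffel_g: "christoffel g p X Y = gam p X Y"
  by (rule christoffel_eqI[where \<Gamma> = "gam p" and p = p and g = g])
     (fact bilinear_g | erule g_pos | fact g_comm | fact gam_sym | fact metric_compatible)+

lemma mu_field_der:
  assumes "(Z has_derivative Z') (at p)"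
  shows "((\<lambda>q. mu q (Z q)) has_derivative (\<lambda>X. dmu p X (Z p) + mu p (Z' X))) (at p)"
  unfolding mu_def conn_def dmu_def
  by (auto intro!: derivative_eq_intros zw_der_intros[OF assms] w_der z_der has_derivative_cnj
      simp: algebra_simps)

text \<open>For an arbitrary field the derivative of its frame components replaces that of a constant field;
  the second component of the derivative is the one of \<open>mu_field_der\<close>.\<close>

lemma
  assumes "(Z has_derivative Z') (at p)"
  shows z_nabla: "z (nabla g X Z p) = z (Z' (X p)) + (om11 p (X p) * z (Z p) + om12 p (X p) * mu p (Z p))"
    and mu_nabla: "mu p (nabla g X Z p) = (dmu p (X p) (Z p) + mu p (Z' (X p)))
        + (om21 p (X p) * z (Z p) + om22 p (X p) * mu p (Z p))"
  unfolding nabla_def christoffel_g frechet_derivative_at[OF assms, symmetric] gam_def by simp_all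

lemma smooth_tau: "smooth_on UNIV (\<lambda>p. tau p X)" and smooth_dmu: "smooth_on UNIV (\<lambda>p. dmu p X Y)"
  unfolding tau_def dmu_def by (intro smooth_intros smooth_conn linear_smooth)+

lemma smooth_om: "smooth_on UNIV (\<lambda>p. om11 p X)" "smooth_on UNIV (\<lambda>p. om12 p X)"
  "smooth_on UNIV (\<lambda>p. om21 p X)" "smooth_on UNIV (\<lambda>p. om22 p X)"
  unfolding om_defs
  by (intro smooth_intros smooth_mu smooth_m smooth_tau linear_smooth smooth_on_compose_linear[OF bounded_linear_cnj])+

lemma smooth_gam: "smooth_on UNIV (\<lambda>p. gam p X Y)"
  unfolding gam_def by (intro smooth_Psi smooth_intros smooth_om smooth_mu smooth_dmu)

section \<open>Curvature\<close>

definition dm :: "'a \<Rightarrow> 'a \<Rightarrow> complex" where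
  "dm p X = - 2 * (m p)\<^sup>2 * dnorm p X"

lemma m_der': "(m has_derivative dm p) (at p)"
  using m_der[of p] unfolding dm_def dnorm_def .

text \<open>Derivatives of the connection forms along \<open>X\<close>, evaluated on the constant field \<open>Y\<close>.\<close>

definition "d_om11 p X Y = 4 * m p * dm p X * cnj (w p) * mu p Y + 2 * (m p)\<^sup>2 * (cnj (w X) * mu p Y + cnj (w p) * dmu p X Y)"
definition "d_om12 p X Y = (4 * m p * dm p X * cnj (w p) + 2 * (m p)\<^sup>2 * cnj (w X)) * z Y"
definition "d_om21 X Y = - 2 * w X * cnj (z Y)"
definition "d_om22 p X Y = tau X Y + dm p X * (w p * cnj (mu p Y) - cnj (w p) * mu p Y)
   + m p * (w X * cnj (mu p Y) + w p * cnj (dmu p X Y) - cnj (w X) * mu p Y - cnj (w p) * dmu p X Y)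
   - 4 * m p * dm p X * cnj (w p) * mu p Y - 2 * (m p)\<^sup>2 * (cnj (w X) * mu p Y + cnj (w p) * dmu p X Y)"

lemma om_der:
  "((\<lambda>q. om11 q Y) has_derivative (\<lambda>X. d_om11 p X Y)) (at p)"
  "((\<lambda>q. om12 q Y) has_derivative (\<lambda>X. d_om12 p X Y)) (at p)"
  "((\<lambda>q. om21 q Y) has_derivative (\<lambda>X. d_om21 X Y)) (at p)"
  "((\<lambda>q. om22 q Y) has_derivative (\<lambda>X. d_om22 p X Y)) (at p)"
  unfolding om_defs d_om11_def d_om12_def d_om21_def d_om22_def tau_def
  by (auto intro!: derivative_eq_intros m_der' mu_der w_der z_der has_derivative_cnj
      simp: algebra_simps power2_eq_square)

text \<open>The curvature matrix \<open>d om + om \<and> om\<close>.  All entries are of type (1,1), as they must be for a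
  Kaehler metric, and each pairs the coframe elements that its position requires for
  invariance under independent rotations of \<open>dz\<close> and \<open>\<mu>\<close>.\<close>

definition "Curv11 p X Y = 2 * (m p)^3 * (2 * m p - 1) * (cnj (mu p X) * mu p Y - cnj (mu p Y) * mu p X)
    + 8 * (m p)\<^sup>2 * w p * cnj (w p) * (cnj (z X) * z Y - cnj (z Y) * z X)"
definition "Curv12 p X Y = 2 * (m p)^3 * (2 * m p - 1) * (cnj (mu p X) * z Y - cnj (mu p Y) * z X)"
definition "Curv21 p X Y = 2 * m p * (2 * m p - 1) * (cnj (z X) * mu p Y - cnj (z Y) * mu p X)"
definition "Curv22 p X Y = - 4 * (m p)^4 * (cnj (mu p X) * mu p Y - cnj (mu p Y) * mu p X)
    + 2 * m p * (2 * m p - 1) * (cnj (z X) * z Y - cnj (z Y) * z X)"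

text \<open>In each of the four identities \<open>dw\<close> and \<open>d\<bar>w\<bar>\<^sup>2\<close> are first rewritten in the coframe, and \<open>d\<mu>\<close>,
  where it occurs, by the structure equation.  Polynomial identities modulo \<open>m_F\<close> remain.\<close>

lemma curvature_form_11:
  "d_om11 p X Y - d_om11 p Y X + om12 p X * om21 p Y - om12 p Y * om21 p X = Curv11 p X Y"
proof -
  have "d_om11 p X Y - d_om11 p Y X = 4 * m p * cnj (w p) * (dm p X * mu p Y - dm p Y * mu p X)
     + 2 * (m p)\<^sup>2 * (cnj (w X) * mu p Y - cnj (w Y) * mu p X + cnj (w p) * (dmu p X Y - dmu p Y X))"
    unfolding d_om11_def by (simp add: algebra_simps)
  moreover have "m p * (1 + 2 * w p * cnj (w p)) = 1" by (rule m_F)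
  ultimately show ?thesis
    unfolding dmu_antisym dm_def om_defs dnorm_eq w_eq[of X p] w_eq[of Y p] Curv11_def
     complex_cnj_add complex_cnj_mult complex_cnj_diff cnj_tau cnj_m complex_cnj_cnj
    by algebra
qed

lemma curvature_form_12:
  "d_om12 p X Y - d_om12 p Y X + om11 p X * om12 p Y + om12 p X * om22 p Y
     - om11 p Y * om12 p X - om12 p Y * om22 p X = Curv12 p X Y"
proof -
  have "m p * (1 + 2 * w p * cnj (w p)) = 1" by (rule m_F)
  then show ?thesis
    unfolding d_om12_def dm_def om_defs dnorm_eq w_eq[of X p] w_eq[of Y p] Curv12_def
     complex_cnj_add complex_cnj_mult complex_cnj_diff cnj_tau cnj_m complex_cnj_cnj
    by algebra
qed

lemma curvature_form_21:
  "d_om21 X Y - d_om21 Y X + om21 p X * om11 p Y + om22 p X * om21 p Y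
     - om21 p Y * om11 p X - om22 p Y * om21 p X = Curv21 p X Y"
proof -
  have "m p * (1 + 2 * w p * cnj (w p)) = 1" by (rule m_F)
  then show ?thesis
    unfolding d_om21_def dm_def om_defs dnorm_eq w_eq[of X p] w_eq[of Y p] Curv21_def
     complex_cnj_add complex_cnj_mult complex_cnj_diff cnj_tau cnj_m complex_cnj_cnj
    by algebra
qed

lemma curvature_form_22:
  "d_om22 p X Y - d_om22 p Y X + om21 p X * om12 p Y - om21 p Y * om12 p X = Curv22 p X Y"
proof -
  have "d_om22 p X Y - d_om22 p Y X = 2 * (cnj (z X) * z Y - cnj (z Y) * z X)
    + w p * (dm p X * cnj (mu p Y) - dm p Y * cnj (mu p X))
    - cnj (w p) * (1 + 4 * m p) * (dm p X * mu p Y - dm p Y * mu p X)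
    + m p * (w X * cnj (mu p Y) - w Y * cnj (mu p X) + w p * cnj (dmu p X Y - dmu p Y X))
    - (m p + 2 * (m p)\<^sup>2) * (cnj (w X) * mu p Y - cnj (w Y) * mu p X + cnj (w p) * (dmu p X Y - dmu p Y X))"
    unfolding d_om22_def tau_def by (simp add: algebra_simps)
  moreover have "m p * (1 + 2 * w p * cnj (w p)) = 1" by (rule m_F)
  ultimately show ?thesis
    unfolding dmu_antisym dm_def om_defs dnorm_eq w_eq[of X p] w_eq[of Y p] Curv22_def
     complex_cnj_add complex_cnj_mult complex_cnj_diff cnj_tau cnj_m complex_cnj_cnj complex_cnj_minus
       complex_cnj_power complex_cnj_numeral
    by algebra
qed

text \<open>The frame components of the field \<open>gam\<close> are products of connection forms and components of a
  constant field, so they can be differentiated without differentiating \<open>Psi\<close>.\<close>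

lemma gam_der:
  obtains G where "((\<lambda>q. gam q Y Z) has_derivative G) (at p)"
    "\<And>X. z (G X) = d_om11 p X Y * z Z + d_om12 p X Y * mu p Z + om12 p Y * dmu p X Z"
    "\<And>X. dmu p X (gam p Y Z) + mu p (G X) = w Y * conn X Z + w X * conn Y Z
       + d_om21 X Y * z Z + d_om22 p X Y * mu p Z + om22 p Y * dmu p X Z"
proof -
  obtain G where G: "((\<lambda>q. gam q Y Z) has_derivative G) (at p)"
    using smooth_on_differentiable[OF smooth_gam] unfolding differentiable_def by blast
  have D: "((\<lambda>q. om11 q Y * z Z + om12 q Y * mu q Z) has_derivative
      (\<lambda>X. d_om11 p X Y * z Z + d_om12 p X Y * mu p Z + om12 p Y * dmu p X Z)) (at p)"
    by (auto intro!: derivative_eq_intros om_der mu_der)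
  have D': "((\<lambda>q. om11 q Y * z Z + om12 q Y * mu q Z) has_derivative (\<lambda>X. z (G X))) (at p)"
    using zw_der_intros(1)[OF G] by (simp add: gam_def)
  have zG: "z (G X) = d_om11 p X Y * z Z + d_om12 p X Y * mu p Z + om12 p Y * dmu p X Z" for X
    using fun_cong[OF has_derivative_unique[OF D' D]] .
  have E: "((\<lambda>q. dmu q Y Z + (om21 q Y * z Z + om22 q Y * mu q Z)) has_derivative
      (\<lambda>X. w Y * conn X Z + w X * conn Y Z
       + d_om21 X Y * z Z + d_om22 p X Y * mu p Z + om22 p Y * dmu p X Z)) (at p)"
    by (auto intro!: derivative_eq_intros om_der mu_der dmu_der)
  have E': "((\<lambda>q. dmu q Y Z + (om21 q Y * z Z + om22 q Y * mu q Z)) has_derivative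
      (\<lambda>X. dmu p X (gam p Y Z) + mu p (G X))) (at p)"
    using mu_field_der[OF G] by (simp add: gam_def)
  have "dmu p X (gam p Y Z) + mu p (G X) = w Y * conn X Z + w X * conn Y Z
       + d_om21 X Y * z Z + d_om22 p X Y * mu p Z + om22 p Y * dmu p X Z" for X
    using fun_cong[OF has_derivative_unique[OF E' E]] .
  then show ?thesis using that[OF G zG] by blast
qed

lemma nabla_const: "nabla g (\<lambda>_. X) (\<lambda>_. Y) = (\<lambda>p. gam p X Y)"
  by (simp add: nabla_def christoffel_g fun_eq_iff)

text \<open>The second derivatives of the frame components of the constant field \<open>Z\<close> are symmetric in \<open>X\<close> and
  \<open>Y\<close> and cancel, as do the mixed terms with one derivative of a component.  Only the matrix
  \<open>d om + om \<and> om\<close> survives.\<close>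

lemma curvature_frame:
  defines "R \<equiv> \<lambda>p X Y Z. curvature_op g (\<lambda>_. X) (\<lambda>_. Y) (\<lambda>_. Z) p"
  shows "z (R p X Y Z) = Curv11 p X Y * z Z + Curv12 p X Y * mu p Z"
    and "mu p (R p X Y Z) = Curv21 p X Y * z Z + Curv22 p X Y * mu p Z"
proof -
  have "nabla g (\<lambda>_. 0) (\<lambda>_. Z) p = 0"
    unfolding nabla_const by (rule frame_eqI[where p = p]) (simp_all add: gam_def om_defs dmu_def tau_def conn_def)
  then have R: "R p X Y Z = nabla g (\<lambda>_. X) (\<lambda>q. gam q Y Z) p - nabla g (\<lambda>_. Y) (\<lambda>q. gam q X Z) p"
    unfolding R_def curvature_op_def lie_bracket_def by (simp add: nabla_const)
  obtain G where G: "((\<lambda>q. gam q Y Z) has_derivative G) (at p)"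
    "\<And>X. z (G X) = d_om11 p X Y * z Z + d_om12 p X Y * mu p Z + om12 p Y * dmu p X Z"
    "\<And>X. dmu p X (gam p Y Z) + mu p (G X) = w Y * conn X Z + w X * conn Y Z
       + d_om21 X Y * z Z + d_om22 p X Y * mu p Z + om22 p Y * dmu p X Z"
    using gam_der by blast
  obtain H where H: "((\<lambda>q. gam q X Z) has_derivative H) (at p)"
    "\<And>Y. z (H Y) = d_om11 p Y X * z Z + d_om12 p Y X * mu p Z + om12 p X * dmu p Y Z"
    "\<And>Y. dmu p Y (gam p X Z) + mu p (H Y) = w X * conn Y Z + w Y * conn X Z
       + d_om21 Y X * z Z + d_om22 p Y X * mu p Z + om22 p X * dmu p Y Z"
    using gam_der by blast
  have z_gam: "z (gam p A B) = om11 p A * z B + om12 p A * mu p B"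
    and mu_gam: "mu p (gam p A B) = dmu p A B + (om21 p A * z B + om22 p A * mu p B)" for A B
    unfolding gam_def by simp_all
  show "z (R p X Y Z) = Curv11 p X Y * z Z + Curv12 p X Y * mu p Z"
    unfolding R zw_linear z_nabla[OF G(1)] z_nabla[OF H(1)] G(2) H(2) z_gam mu_gam
      curvature_form_11[symmetric] curvature_form_12[symmetric]
    by (simp add: algebra_simps)
  show "mu p (R p X Y Z) = Curv21 p X Y * z Z + Curv22 p X Y * mu p Z"
    unfolding R mu_linear mu_nabla[OF G(1)] mu_nabla[OF H(1)] G(3) H(3) z_gam mu_gam
      curvature_form_21[symmetric] curvature_form_22[symmetric]
    by (simp add: algebra_simps)
qed

section \<open>The complex structure and its opposite\<close>

text \<open>Multiplication by \<open>\<epsilon> \<i>\<close> on the horizontal and by \<open>\<i>\<close> on the vertical component.  Both signs are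
  treated at once: \<open>1\<close> is the Kaehler structure and \<open>-1\<close> its opposite.\<close>

definition cs :: "real \<Rightarrow> 'a endo_field" where
  "cs \<epsilon> p X = Psi p (of_real \<epsilon> * \<i> * z X) (\<i> * mu p X)"

abbreviation "J \<equiv> cs 1"

abbreviation "I \<equiv> cs (- 1)"

lemma cs_simps [simp]: "z (cs \<epsilon> p X) = of_real \<epsilon> * \<i> * z X" "mu p (cs \<epsilon> p X) = \<i> * mu p X"
  by (simp_all add: cs_def)

text \<open>Substituting \<open>J X\<close> for the second argument turns each form \<open>\<phi>\<^sup>* \<and> \<chi>\<close> of the curvature matrix into
  \<open>2 \<i> \<phi>(X)\<^sup>* \<chi>(X)\<close>, and the phases cancel against those of \<open>J X\<close> and \<open>X\<close>.\<close>

lemma curvature_holomorphic: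
  "curvature g p X (J p X) (J p X) X = s * (
     - 16 * (cmod (w p))\<^sup>2 / F p * ((cmod (z X))\<^sup>2)\<^sup>2
     - 16 * (2 / F p - 1) / (F p)\<^sup>2 * (cmod (z X))\<^sup>2 * (cmod (mu p X))\<^sup>2
     + 8 / (F p)^5 * ((cmod (mu p X))\<^sup>2)\<^sup>2)"
proof -
  define x where "x = (cmod (z X))\<^sup>2"
  define y where "y = (cmod (mu p X))\<^sup>2"
  define h where "h = (cmod (w p))\<^sup>2"
  define n where "n = 1 / F p"
  have F: "n * F p = 1" by (simp add: n_def)
  have mn: "m p = of_real n" by (simp add: m_eq n_def)
  have x: "z X * cnj (z X) = of_real x" "cnj (z X) * z X = of_real x"
    and y: "mu p X * cnj (mu p X) = of_real y" "cnj (mu p X) * mu p X = of_real y"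
    and h: "w p * cnj (w p) = of_real h"
    by (simp_all only: x_def y_def h_def complex_norm_square mult.commute)
  let ?R = "curvature_op g (\<lambda>_. X) (\<lambda>_. J p X) (\<lambda>_. J p X) p"
  have a: "cnj (z ?R) * z X = - of_real (2 * (2 * n^3 * (2 * n - 1) * y + 8 * n\<^sup>2 * h * x) * x
      + 4 * n^3 * (2 * n - 1) * y * x)"
  proof -
    have "cnj (z ?R) * z X = - 2 * (2 * m p^3 * (2 * m p - 1) * (mu p X * cnj (mu p X)) + 8 * (m p)\<^sup>2 * (w p * cnj (w p)) * (z X * cnj (z X)))
        * (z X * cnj (z X)) - 4 * m p^3 * (2 * m p - 1) * (mu p X * cnj (mu p X)) * (z X * cnj (z X))"
      unfolding curvature_frame Curv11_def Curv12_def by (simp add: algebra_simps)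
    then show ?thesis unfolding x y h mn by (simp add: algebra_simps)
  qed
  have b: "cnj (mu p ?R) * mu p X = - of_real (4 * n * (2 * n - 1) * x * y
      + 2 * (- 4 * n^4 * y + 2 * n * (2 * n - 1) * x) * y)"
  proof -
    have "cnj (mu p ?R) * mu p X = - 4 * m p * (2 * m p - 1) * (z X * cnj (z X)) * (mu p X * cnj (mu p X))
     - 2 * (- 4 * m p^4 * (mu p X * cnj (mu p X)) + 2 * m p * (2 * m p - 1) * (z X * cnj (z X))) * (mu p X * cnj (mu p X))"
      unfolding curvature_frame Curv21_def Curv22_def by (simp add: algebra_simps)
    then show ?thesis unfolding x y mn by (simp add: algebra_simps)
  qed
  have re: "Re (- complex_of_real r) = - r" and dv: "- r / F p = - (n * r)" for r
    by (simp_all add: n_def)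
  have "curvature g p X (J p X) (J p X) X = s * (F p * (- (2 * (2 * n^3 * (2 * n - 1) * y + 8 * n\<^sup>2 * h * x) * x
      + 4 * n^3 * (2 * n - 1) * y * x)) - n * (4 * n * (2 * n - 1) * x * y
      + 2 * (- 4 * n^4 * y + 2 * n * (2 * n - 1) * x) * y))"
    unfolding curvature_def g_eq a b re dv by (simp only: diff_conv_add_uminus)
  also have "\<dots> = s * (- 16 * h * n * x\<^sup>2 - 16 * (2 * n - 1) * n\<^sup>2 * x * y + 8 * n^5 * y\<^sup>2)"
    using F by algebra
  finally show ?thesis
    unfolding x_def[symmetric] y_def[symmetric] h_def[symmetric] n_def by (simp add: power_divide)
qed

lemma Psi_eq_iff: "Psi p x y = Psi p x' y' \<longleftrightarrow> x = x' \<and> y = y'"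
  by (metis z_Psi mu_Psi)

lemma smooth_endo_cs: "smooth_endo S (cs \<epsilon>)"
  unfolding smooth_endo_def
proof (intro conjI ballI allI)
  show "linear (cs \<epsilon> p)" for p
    by (intro linearI; rule frame_eqI[where p = p]; simp add: algebra_simps)
  show "smooth_on S (\<lambda>p. cs \<epsilon> p X)" for X
    unfolding cs_def
    by (rule smooth_on_subset[of UNIV]) (intro smooth_Psi smooth_intros smooth_mu, simp)
qed

lemma almost_hermitian_cs:
  assumes "\<epsilon> * \<epsilon> = 1"
  shows "almost_hermitian S g (cs \<epsilon>)"
  unfolding almost_hermitian_def
proof (intro conjI ballI allI riemannian smooth_endo_cs)
  have e: "complex_of_real \<epsilon> * complex_of_real \<epsilon> = 1"
    using assms by (metis of_real_1 of_real_mult)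
  show "cs \<epsilon> p (cs \<epsilon> p X) = - X" for p X
    by (rule frame_eqI[where p = p]) (use e in \<open>simp_all add: algebra_simps\<close>)
  have "cnj (of_real \<epsilon> * \<i> * x) * (of_real \<epsilon> * \<i> * y) = cnj x * y" for x y
  proof -
    have "cnj (of_real \<epsilon> * \<i> * x) * (of_real \<epsilon> * \<i> * y) = (complex_of_real \<epsilon> * complex_of_real \<epsilon>) * (cnj x * y)"
      by (simp add: algebra_simps)
    then show ?thesis unfolding e by simp
  qed
  moreover have "cnj (\<i> * x) * (\<i> * y) = cnj x * y" for x y
    by (simp add: algebra_simps)
  ultimately show "g p (cs \<epsilon> p X) (cs \<epsilon> p Y) = g p X Y" for p X Y
    unfolding g_def cs_simps by simp
qed

text \<open>The frame components of \<open>cs \<epsilon> q Y\<close> are constant multiples of those of \<open>Y\<close>.\<close>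

lemma cs_der:
  obtains G where "((\<lambda>q. cs \<epsilon> q Y) has_derivative G) (at p)"
    "\<And>X. z (G X) = 0" "\<And>X. mu p (G X) = \<i> * dmu p X Y - dmu p X (cs \<epsilon> p Y)"
proof -
  have "smooth_on UNIV (\<lambda>q. cs \<epsilon> q Y)" using smooth_endo_cs[of UNIV] unfolding smooth_endo_def by blast
  then obtain G where G: "((\<lambda>q. cs \<epsilon> q Y) has_derivative G) (at p)"
    using smooth_on_differentiable unfolding differentiable_def by blast
  have D: "((\<lambda>q. of_real \<epsilon> * \<i> * z Y) has_derivative (\<lambda>X. 0)) (at p)" by simp
  have D': "((\<lambda>q. of_real \<epsilon> * \<i> * z Y) has_derivative (\<lambda>X. z (G X))) (at p)"
    using zw_der_intros(1)[OF G] by simp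
  have zG: "z (G X) = 0" for X
    using fun_cong[OF has_derivative_unique[OF D' D]] .
  have E: "((\<lambda>q. \<i> * mu q Y) has_derivative (\<lambda>X. \<i> * dmu p X Y)) (at p)"
    by (auto intro!: derivative_eq_intros mu_der)
  have E': "((\<lambda>q. \<i> * mu q Y) has_derivative (\<lambda>X. dmu p X (cs \<epsilon> p Y) + mu p (G X))) (at p)"
    using mu_field_der[OF G] by simp
  have "mu p (G X) = \<i> * dmu p X Y - dmu p X (cs \<epsilon> p Y)" for X
    using fun_cong[OF has_derivative_unique[OF E' E], of X] by (simp add: algebra_simps)
  then show ?thesis using that G zG by blast
qed

lemma tau_cs: "tau p (cs \<epsilon> p X) = of_real \<epsilon> * \<i> * (cnj (z p) * z X + z p * cnj (z X))"
  by (simp add: tau_def algebra_simps)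

text \<open>The horizontal component vanishes since \<open>dz\<close> is closed.  The vertical one is the part of \<open>d\<mu>\<close> of
  type (0,2) for the structure at hand, and the structure equation shows that there is none:
  for both signs \<open>d\<mu>\<close> lies in the ideal generated by the (1,0)-forms.\<close>

lemma nijenhuis_cs:
  assumes "\<epsilon> * \<epsilon> = 1"
  shows "nijenhuis (cs \<epsilon>) p X Y = 0"
proof -
  obtain G where G: "((\<lambda>q. cs \<epsilon> q Y) has_derivative G) (at p)"
    "\<And>X. z (G X) = 0" "\<And>X. mu p (G X) = \<i> * dmu p X Y - dmu p X (cs \<epsilon> p Y)"
    using cs_der by blast
  obtain H where H: "((\<lambda>q. cs \<epsilon> q X) has_derivative H) (at p)"
    "\<And>Y. z (H Y) = 0" "\<And>Y. mu p (H Y) = \<i> * dmu p Y X - dmu p Y (cs \<epsilon> p X)"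
    using cs_der by blast
  have N: "nijenhuis (cs \<epsilon>) p X Y = G (cs \<epsilon> p X) - H (cs \<epsilon> p Y) - cs \<epsilon> p (- H Y) - cs \<epsilon> p (G X)"
    unfolding nijenhuis_def lie_bracket_def frechet_derivative_at[OF G(1), symmetric]
      frechet_derivative_at[OF H(1), symmetric] by simp
  \<comment> \<open>The terms combine so that only the antisymmetric part of \<open>dmu\<close>, the form \<open>d\<mu>\<close>, remains.\<close>
  define E where "E X Y = dmu p X Y - dmu p Y X" for X Y
  have "mu p (nijenhuis (cs \<epsilon>) p X Y) =
      \<i> * E (cs \<epsilon> p X) Y + \<i> * E X (cs \<epsilon> p Y) - E (cs \<epsilon> p X) (cs \<epsilon> p Y) + E X Y"
    unfolding N mu_linear G(3) H(3) cs_simps E_def by (simp add: algebra_simps)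
  also have "\<dots> = 0"
  proof -
    have "complex_of_real \<epsilon> * complex_of_real \<epsilon> = 1"
      using assms by (metis of_real_1 of_real_mult)
    moreover have "\<i> * \<i> = -1" by simp
    ultimately show ?thesis
      unfolding E_def dmu_antisym om21_def om22_def tau_cs tau_def cs_simps complex_cnj_mult complex_cnj_complex_of_real complex_cnj_i
      by algebra
  qed
  finally show ?thesis
    by (intro frame_eqI[where p = p]) (simp_all add: N G(2) H(2))
qed

lemma hermitian_cs: "\<epsilon> * \<epsilon> = 1 \<Longrightarrow> hermitian S g (cs \<epsilon>)"
  unfolding hermitian_def using almost_hermitian_cs nijenhuis_cs by blast

section \<open>The two Kaehler forms\<close>

text \<open>The form \<open>\<mu>\<^sup>* \<and> \<mu> / F\<close>, written as the polynomial that \<open>wedge_mu\<close> provides.\<close>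

definition vform :: "'a \<Rightarrow> 'a \<Rightarrow> 'a \<Rightarrow> complex" where
  "vform p X Y = cnj (w X) * w Y - cnj (w Y) * w X + dnorm p X * tau p Y - dnorm p Y * tau p X"

lemma kaehler_form_cs:
  "kaehler_form g (cs \<epsilon>) p X Y = s / 2 * Im (of_real \<epsilon> * (1 + 2 * w p * cnj (w p)) * tau X Y + vform p X Y)"
proof -
  have 1: "Re (cnj (of_real \<epsilon> * \<i> * x) * y) = \<epsilon> * Im (cnj x * y)" "Re (cnj (\<i> * x) * y) = Im (cnj x * y)" for x y
    by (simp_all add: algebra_simps)
  have 2: "Im (cnj x * y) = Im (cnj x * y - cnj y * x) / 2" for x y by simp
  have 3: "Im (cnj (mu p X) * mu p Y) / F p = Im (vform p X Y) / 2"
    unfolding 2 wedge_mu of_real_F[symmetric] vform_def[symmetric] by simp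
  have 4: "Im (cnj (z X) * z Y) = Im (tau X Y) / 2" by (simp add: tau_def)
  have 5: "Im (of_real \<epsilon> * of_real (F p) * tau X Y + vform p X Y) = \<epsilon> * F p * Im (tau X Y) + Im (vform p X Y)"
    by simp
  show ?thesis
    unfolding kaehler_form_def g_eq cs_simps 1 of_real_F[symmetric] 5 3 4
    by (simp add: algebra_simps add_divide_distrib)
qed

lemma dnorm_der: "((\<lambda>q. dnorm q Y) has_derivative (\<lambda>X. dnorm X Y)) (at p)"
  and tau_der: "((\<lambda>q. tau q Y) has_derivative (\<lambda>X. tau X Y)) (at p)"
  unfolding dnorm_def tau_def by (auto intro!: derivative_eq_intros w_der z_der has_derivative_cnj)

lemma kaehler_form_der:
  "((\<lambda>q. kaehler_form g (cs \<epsilon>) q Y Z) has_derivative (\<lambda>X. s / 2 * Im (2 * of_real \<epsilon> * dnorm p X * tau Y Z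
     + dnorm X Y * tau p Z + dnorm p Y * tau X Z - dnorm X Z * tau p Y - dnorm p Z * tau X Y))) (at p)"
  unfolding kaehler_form_cs vform_def
  by (rule has_derivative_eq_rhs,
      rule has_derivative_mult_right, rule has_derivative_Im,
      (rule derivative_intros dnorm_der tau_der w_der)+)
     (auto simp: dnorm_def algebra_simps)

text \<open>Both halves of the Kaehler form have the same exterior derivative up to sign, a multiple of
  \<open>d\<bar>w\<bar>\<^sup>2 \<and> dz\<^sup>* \<and> dz\<close>: the horizontal one from \<open>dF\<close>, the vertical one from the curvature of the
  connection form.  They cancel for \<open>J\<close> and add up for \<open>I\<close>.\<close>

lemma ext_deriv_kaehler_form:
  "ext_deriv2 (kaehler_form g (cs \<epsilon>)) p X Y Z
     = s * Im ((of_real \<epsilon> - 1) * (dnorm p X * tau Y Z + dnorm p Y * tau Z X + dnorm p Z * tau X Y))"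
proof -
  have dnorm_sym: "dnorm Y X = dnorm X Y" for X Y by (simp add: dnorm_def)
  have tau_anti: "tau Y X = - tau X Y" for X Y by (simp add: tau_def)
  have "2 * of_real \<epsilon> * dnorm p X * tau Y Z + dnorm X Y * tau p Z + dnorm p Y * tau X Z - dnorm X Z * tau p Y - dnorm p Z * tau X Y
    + (2 * of_real \<epsilon> * dnorm p Y * tau Z X + dnorm Y Z * tau p X + dnorm p Z * tau Y X - dnorm Y X * tau p Z - dnorm p X * tau Y Z)
    + (2 * of_real \<epsilon> * dnorm p Z * tau X Y + dnorm Z X * tau p Y + dnorm p X * tau Z Y - dnorm Z Y * tau p X - dnorm p Y * tau Z X)
    = 2 * ((of_real \<epsilon> - 1) * (dnorm p X * tau Y Z + dnorm p Y * tau Z X + dnorm p Z * tau X Y))"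
    unfolding dnorm_sym[of Y X] dnorm_sym[of Z X] dnorm_sym[of Z Y] tau_anti[of X Y] tau_anti[of X Z] tau_anti[of Y Z]
    by (simp add: algebra_simps)
  then show ?thesis
    unfolding ext_deriv2_def frechet_derivative_at[OF kaehler_form_der, symmetric]
      distrib_left[symmetric] plus_complex.sel(2)[symmetric] by simp
qed

lemma kaehler_J: "kaehler S g J"
  unfolding kaehler_def using hermitian_cs[of 1] ext_deriv_kaehler_form[of 1] by simp

lemma kaehler_surface_J: "open S \<Longrightarrow> S \<noteq> {} \<Longrightarrow> kaehler_surface S g J"
  unfolding kaehler_surface_def using kaehler_J dim4 by blast

section \<open>Quasi-constant holomorphic curvature\<close>

definition D :: "'a \<Rightarrow> 'a set" where
  "D p = {X. z X = 0}"

lemma orth_proj_D: "orth_proj g D p X = Psi p 0 (mu p X)"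
  unfolding orth_proj_def
proof (rule the_equality)
  show "Psi p 0 (mu p X) \<in> D p \<and> (\<forall>Z\<in>D p. g p (X - Psi p 0 (mu p X)) Z = 0)"
    by (simp add: D_def g_def)
  fix Y assume Y: "Y \<in> D p \<and> (\<forall>Z\<in>D p. g p (X - Y) Z = 0)"
  let ?Z = "Psi p 0 (mu p (X - Y))"
  have "g p ?Z ?Z = g p (X - Y) ?Z" by (simp add: g_def)
  also have "\<dots> = 0" using Y by (simp add: D_def del: mu_linear)
  finally have "?Z = 0" using g_pos[of ?Z p] by force
  then have "mu p (X - Y) = 0" by (metis mu_Psi mu_linear(5))
  then show "Y = Psi p 0 (mu p X)"
    using Y by (intro frame_eqI[where p = p]) (simp_all add: D_def)
qed

lemma opposite_structure_J: "opposite_structure g J D = I"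
proof (intro ext)
  fix p X
  show "opposite_structure g J D p X = I p X"
    unfolding opposite_structure_def orth_proj_D by (rule frame_eqI[where p = p]) simp_all
qed

lemma span_vertical:
  assumes "\<zeta> \<noteq> 0"
  shows "span {Psi p 0 \<zeta>, Psi p 0 (\<i> * \<zeta>)} = D p"
proof
  show "span {Psi p 0 \<zeta>, Psi p 0 (\<i> * \<zeta>)} \<subseteq> D p"
    by (rule span_minimal) (auto simp: D_def subspace_def)
  show "D p \<subseteq> span {Psi p 0 \<zeta>, Psi p 0 (\<i> * \<zeta>)}"
  proof
    fix X assume X: "X \<in> D p"
    define q where "q = mu p X / \<zeta>"
    have "mu p X = (of_real (Re q) + \<i> * of_real (Im q)) * \<zeta>"
      using assms complex_eq[of q] by (simp add: q_def)
    then have "X = Re q *\<^sub>R Psi p 0 \<zeta> + Im q *\<^sub>R Psi p 0 (\<i> * \<zeta>)"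
      using X by (intro frame_eqI[where p = p]) (simp_all add: D_def scaleR_conv_of_real algebra_simps)
    then show "X \<in> span {Psi p 0 \<zeta>, Psi p 0 (\<i> * \<zeta>)}"
      by (metis insertCI span_add span_base span_scale)
  qed
qed

lemma dim_D: "dim (D p) = 2"
proof -
  have lin: "linear (\<lambda>b. Psi p 0 b)"
    by (intro linearI; rule frame_eqI[where p = p]; simp)
  have "D p = range (\<lambda>b. Psi p 0 b)"
  proof -
    have "X = Psi p 0 (mu p X)" if "z X = 0" for X using that Psi_frame[of p X] by simp
    then show ?thesis unfolding D_def by auto
  qed
  moreover have "dim (range (\<lambda>b. Psi p 0 b)) = dim (UNIV :: complex set)"
    by (rule dim_image_eq[OF lin]) (auto intro!: inj_onI simp: Psi_eq_iff)
  ultimately show ?thesis by simp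
qed

lemma smooth_distribution_D:
  assumes "open S"
  shows "smooth_2_distribution S D"
  unfolding smooth_2_distribution_def
proof (intro conjI ballI)
  show "subspace (D p)" "dim (D p) = 2" for p
    by (auto simp: D_def subspace_def dim_D[unfolded D_def])
  have sm: "smooth_on S (\<lambda>p. Psi p 0 b)" for b
    by (rule smooth_on_subset[of UNIV]) (intro smooth_Psi smooth_intros, simp)
  have "\<forall>q\<in>S. D q = span {Psi q 0 1, Psi q 0 (\<i> * 1)}" using span_vertical[of 1] by simp
  then show "\<exists>V E F. open V \<and> p \<in> V \<and> V \<subseteq> S \<and> smooth_on V E \<and> smooth_on V F
      \<and> (\<forall>q\<in>V. D q = span {E q, F q})" if "p \<in> S" for p
    using assms that sm by blast
qed

text \<open>The function \<open>K\<close> is \<open>curvature_holomorphic\<close> with \<open>\<bar>\<mu>(X)\<bar>\<^sup>2 = F T\<^sup>2 / s\<close> and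
  \<open>\<bar>dz(X)\<bar>\<^sup>2 = (1 - T\<^sup>2) / (s F)\<close>, where \<open>T\<close> is the length of the projection of the unit vector
  \<open>X\<close>.\<close>

lemma qch_D:
  assumes "open S"
  shows "qch_distribution S g J D"
  unfolding qch_distribution_def
proof (intro conjI smooth_distribution_D[OF assms] ballI exI allI impI; (elim conjE)?)
  show "J p ` D p \<subseteq> D p" for p by (auto simp: D_def)
  let ?K = "\<lambda>p T. s * (
     - 16 * (cmod (w p))\<^sup>2 / F p * ((1 - T\<^sup>2) / (s * F p))\<^sup>2
     - 16 * (2 / F p - 1) / (F p)\<^sup>2 * ((1 - T\<^sup>2) / (s * F p)) * (F p * T\<^sup>2 / s)
     + 8 / (F p)^5 * (F p * T\<^sup>2 / s)\<^sup>2)"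
  fix p X assume X: "g p X X = 1"
  define T where "T = sqrt (g p (orth_proj g D p X) (orth_proj g D p X))"
  have "g p (orth_proj g D p X) (orth_proj g D p X) = s * (cmod (mu p X))\<^sup>2 / F p"
    unfolding orth_proj_D g_eq cmod_power2 by (simp add: power2_eq_square)
  then have T: "T\<^sup>2 = s * (cmod (mu p X))\<^sup>2 / F p"
    unfolding T_def using s_pos less_imp_le[OF F_pos[of p]] by simp
  then have mu: "F p * T\<^sup>2 / s = (cmod (mu p X))\<^sup>2" using s_pos by simp
  have "1 = s * (F p * (cmod (z X))\<^sup>2 + (cmod (mu p X))\<^sup>2 / F p)"
    unfolding X[symmetric] g_eq cmod_power2 by (simp add: power2_eq_square)
  then have "1 - T\<^sup>2 = s * F p * (cmod (z X))\<^sup>2" unfolding T by (simp add: algebra_simps)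
  then have z: "(1 - T\<^sup>2) / (s * F p) = (cmod (z X))\<^sup>2" using s_pos by simp
  show "curvature g p X (J p X) (J p X) X = ?K p (sqrt (g p (orth_proj g D p X) (orth_proj g D p X)))"
    unfolding T_def[symmetric] mu z curvature_holomorphic by (simp add: mult.assoc)
qed

section \<open>Calabi type\<close>

definition U :: "'a set" where
  "U = {p. w p \<noteq> 0}"

lemma open_U: "open U"
proof -
  have "continuous_on UNIV w" using bl_w by (rule linear_continuous_on)
  then have "open (w -` (- {0}))" by (intro open_vimage) auto
  then show ?thesis by (simp add: U_def vimage_def)
qed

text \<open>Moving in the direction \<open>(1, 1)\<close> leaves both coordinate axes after an arbitrarily small step, since
  at most two real step lengths are bad.\<close>

lemma dense_regular: "closure {p. z p \<noteq> 0 \<and> w p \<noteq> 0} = UNIV"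
proof -
  have "\<exists>q. z q \<noteq> 0 \<and> w q \<noteq> 0 \<and> dist q p < e" if "e > 0" for p e
  proof -
    let ?v = "vec 1 1"
    have v: "norm ?v > 0"
      by (metis norm_le_zero_iff not_le z_vec zw_linear(1) zero_neq_one)
    define d where "d = e / norm ?v"
    have "d > 0" using that v by (simp add: d_def)
    have "infinite ({0<..<d} - {- Re (z p), - Re (w p)})"
      using \<open>d > 0\<close> infinite_Ioo by (intro Diff_infinite_finite) auto
    then obtain r where r: "r \<in> {0<..<d} - {- Re (z p), - Re (w p)}"
      by (metis finite.emptyI ex_in_conv)
    have "Re (z (p + r *\<^sub>R ?v)) \<noteq> 0" "Re (w (p + r *\<^sub>R ?v)) \<noteq> 0" using r by auto
    then have "z (p + r *\<^sub>R ?v) \<noteq> 0" "w (p + r *\<^sub>R ?v) \<noteq> 0"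
      by (metis zero_complex.sel(1))+
    moreover have "dist (p + r *\<^sub>R ?v) p < e"
      using r v by (simp add: dist_norm d_def pos_less_divide_eq)
    ultimately show ?thesis by blast
  qed
  then show ?thesis by (force simp: closure_approachable)
qed

lemma dense_U: "closure U = UNIV"
  using closure_mono[of "{p. z p \<noteq> 0 \<and> w p \<noteq> 0}" U] dense_regular unfolding U_def by auto

lemma U_nonempty: "U \<noteq> {}"
  using dense_U by auto

text \<open>The logarithmic derivative \<open>dF / F\<close>.\<close>

definition lee :: "'a one_form" where
  "lee p X = Re (2 * m p * dnorm p X)"

lemma smooth_lee: "smooth_one_form S lee"
  unfolding smooth_one_form_def
proof (intro conjI ballI allI)
  show "linear (lee p)" for p
    by (intro linearI) (simp_all add: lee_def dnorm_def algebra_simps)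
  have "smooth_on UNIV (\<lambda>p. lee p X)" for X
    unfolding lee_def dnorm_def
    by (intro smooth_on_compose_linear[OF bounded_linear_Re] smooth_intros smooth_m linear_smooth)
  then show "smooth_on S (\<lambda>p. lee p X)" for X by (rule smooth_on_subset) simp
qed

text \<open>Only the horizontal half of the Kaehler form contributes to its product with \<open>dF\<close>: the vertical
  half is the sum of \<open>dw\<^sup>* \<and> dw\<close> and of a multiple of \<open>d\<bar>w\<bar>\<^sup>2\<close>, and the product of \<open>d\<bar>w\<bar>\<^sup>2\<close> with either is zero.
  The factor \<open>F\<close> of the horizontal half then cancels.\<close>

lemma lee_I: "lee_form S g I lee"
  unfolding lee_form_def
proof (intro conjI ballI allI smooth_lee)
  fix p X Y Z
  let ?F = "1 + 2 * w p * cnj (w p)"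
  have mult: "Re (2 * m p * dnorm p X) * (s / 2 * Im b) = s * Im (m p * dnorm p X * b)" for X b
  proof -
    have "m p * dnorm p X = of_real (Re (dnorm p X) / F p)"
      by (simp add: m_eq dnorm_def complex_eq_iff)
    then show ?thesis by (simp add: mult.assoc)
  qed
  have lw: "lee p X * kaehler_form g I p Y Z = s * Im (m p * dnorm p X * vform p Y Z - dnorm p X * tau Y Z)" for X Y Z
  proof -
    have "lee p X * kaehler_form g I p Y Z = s * Im (m p * dnorm p X * vform p Y Z - (m p * ?F) * (dnorm p X * tau Y Z))"
      unfolding lee_def kaehler_form_cs mult by (simp add: algebra_simps)
    then show ?thesis unfolding m_F by simp
  qed
  have "dnorm p X * vform p Y Z + dnorm p Y * vform p Z X + dnorm p Z * vform p X Y = 0"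
    by (simp add: vform_def dnorm_def algebra_simps)
  then have eq: "m p * dnorm p X * vform p Y Z - dnorm p X * tau Y Z + (m p * dnorm p Y * vform p Z X - dnorm p Y * tau Z X)
    + (m p * dnorm p Z * vform p X Y - dnorm p Z * tau X Y) = - (dnorm p X * tau Y Z + dnorm p Y * tau Z X + dnorm p Z * tau X Y)"
    by algebra
  have "wedge_1_2 (lee p) (kaehler_form g I p) X Y Z
      = - (s * Im (dnorm p X * tau Y Z + dnorm p Y * tau Z X + dnorm p Z * tau X Y))"
    unfolding wedge_1_2_def lw distrib_left[of s, symmetric] plus_complex.sel(2)[symmetric] eq
      uminus_complex.sel mult_minus_right ..
  moreover have "Im ((of_real (- 1) - 1) * b) = - 2 * Im b" for b by simp
  ultimately show "ext_deriv2 (kaehler_form g I) p X Y Z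
      = 2 * wedge_1_2 (lee p) (kaehler_form g I p) X Y Z"
    unfolding ext_deriv_kaehler_form by (simp only: mult_minus_right mult_minus_left mult.left_commute)
qed

text \<open>Since the matrix of \<open>cs \<epsilon>\<close> in the frame is constant, its covariant derivative is a commutator with
  the connection matrix; the diagonal entries drop out.\<close>

lemma
  fixes \<epsilon> :: real
  shows z_nabla_cs: "z (nabla_endo g (cs \<epsilon>) p X Y) = \<i> * of_real (1 - \<epsilon>) * om12 p X * mu p Y"
    and mu_nabla_cs: "mu p (nabla_endo g (cs \<epsilon>) p X Y) = \<i> * of_real (\<epsilon> - 1) * om21 p X * z Y"
proof -
  obtain G where G: "((\<lambda>q. cs \<epsilon> q Y) has_derivative G) (at p)"
    "\<And>X. z (G X) = 0" "\<And>X. mu p (G X) = \<i> * dmu p X Y - dmu p X (cs \<epsilon> p Y)"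
    using cs_der by blast
  show "z (nabla_endo g (cs \<epsilon>) p X Y) = \<i> * of_real (1 - \<epsilon>) * om12 p X * mu p Y"
    unfolding nabla_endo_def zw_linear z_nabla[OF G(1)] nabla_const by (simp add: G gam_def algebra_simps)
  show "mu p (nabla_endo g (cs \<epsilon>) p X Y) = \<i> * of_real (\<epsilon> - 1) * om21 p X * z Y"
    unfolding nabla_endo_def mu_linear mu_nabla[OF G(1)] nabla_const by (simp add: G gam_def algebra_simps)
qed

lemma nabla_I_kernel:
  assumes "p \<in> U"
  shows "{X. \<forall>Y. nabla_endo g I p X Y = 0} = D p"
proof (intro set_eqI iffI)
  fix X assume X: "X \<in> {X. \<forall>Y. nabla_endo g I p X Y = 0}"
  have "mu p (nabla_endo g I p X (Psi p 1 0)) = 0" using X by simp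
  then show "X \<in> D p"
    using assms unfolding mu_nabla_cs by (simp add: om21_def D_def U_def)
next
  fix X assume "X \<in> D p"
  then show "X \<in> {X. \<forall>Y. nabla_endo g I p X Y = 0}"
    by (auto intro!: frame_eqI[where p = p] simp: z_nabla_cs mu_nabla_cs om12_def om21_def D_def)
qed

lemma orthonormal_basis_exists: "\<exists>B. orthonormal_basis g p B"
proof -
  \<comment> \<open>The weights normalise the horizontal and vertical frame vectors, of squared lengths \<open>s F\<close> and \<open>s / F\<close>.\<close>
  define r where "r = sqrt (1 / (s * F p))"
  define q where "q = sqrt (F p / s)"
  have r: "r \<noteq> 0" "s * (F p * (r * r)) = 1" and q: "q \<noteq> 0" "s * (q * q / F p) = 1"
    using s_pos F_pos[of p] less_imp_le[OF F_pos[of p]] by (simp_all add: r_def q_def)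
  let ?B = "{Psi p r 0, Psi p (\<i> * r) 0, Psi p 0 q, Psi p 0 (\<i> * q)}"
  have "span ?B = UNIV"
  proof (intro set_eqI iffI UNIV_I)
    fix X
    have "X = (Re (z X) / r) *\<^sub>R Psi p r 0 + (Im (z X) / r) *\<^sub>R Psi p (\<i> * r) 0
        + (Re (mu p X) / q) *\<^sub>R Psi p 0 q + (Im (mu p X) / q) *\<^sub>R Psi p 0 (\<i> * q)"
      using r q by (intro frame_eqI[where p = p]) (simp_all add: complex_eq_iff)
    then show "X \<in> span ?B"
      by (metis (no_types, lifting) insertCI span_add span_base span_scale)
  qed
  moreover have "\<forall>e\<in>?B. \<forall>f\<in>?B. g p e f = (if e = f then 1 else 0)"
    using r q by (auto simp: g_eq Psi_eq_iff)
  ultimately show ?thesis unfolding orthonormal_basis_def by blast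
qed

text \<open>If the norm vanished, \<open>\<nabla>I\<close> would be zero on an orthonormal basis, hence everywhere, and the
  kernel of \<open>\<nabla>I\<close> would be larger than \<open>D\<close>.\<close>

lemma norm_nabla_I:
  assumes "p \<in> U"
  shows "norm_nabla_endo g I p > 0"
proof -
  define B where "B = (SOME B. orthonormal_basis g p B)"
  have B: "orthonormal_basis g p B"
    unfolding B_def by (rule someI_ex[OF orthonormal_basis_exists])
  have "independent B"
    unfolding dependent_def
  proof (intro notI, elim bexE)
    fix e assume e: "e \<in> B" and span: "e \<in> span (B - {e})"
    have lin: "linear (g p e)" using bilinear_g unfolding bilinear_def by blast
    have "g p e f = 0" if "f \<in> B - {e}" for f
      using B e that unfolding orthonormal_basis_def by auto
    then have "g p e e = 0" using linear_eq_0_on_span[OF lin _ span] by blast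
    then show False using B e unfolding orthonormal_basis_def by simp
  qed
  then have fin: "finite B" by (rule independent_imp_finite)
  let ?N = "nabla_endo g I p"
  have nonneg: "g p X X \<ge> 0" for X
    using g_pos[of X p] bilinear_lzero[OF bilinear_g] by (cases "X = 0") force+
  have lin: "linear (\<lambda>X. ?N X Y)" "linear (?N X)" for X Y
    by (intro linearI; rule frame_eqI[where p = p];
        simp add: z_nabla_cs mu_nabla_cs om12_def om21_def algebra_simps)+
  have "(\<Sum>e\<in>B. \<Sum>f\<in>B. g p (?N e f) (?N e f)) \<noteq> 0"
  proof
    assume "(\<Sum>e\<in>B. \<Sum>f\<in>B. g p (?N e f) (?N e f)) = 0"
    then have "\<forall>e\<in>B. \<forall>f\<in>B. g p (?N e f) (?N e f) = 0"
      using fin nonneg by (simp add: sum_nonneg_eq_0_iff sum_nonneg)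
    then have N: "?N e f = 0" if "e \<in> B" "f \<in> B" for e f
      using g_pos[of "?N e f" p] that by force
    have span: "span B = UNIV" using B unfolding orthonormal_basis_def by blast
    have "?N e Y = 0" if "e \<in> B" for e Y
      using linear_eq_0_on_span[OF lin(2)[of e], of B Y] N that span by blast
    then have "?N X Y = 0" for X Y
      using linear_eq_0_on_span[OF lin(1)[of Y], of B X] span by blast
    then have "Psi p 1 0 \<in> D p" using nabla_I_kernel[OF assms] by blast
    then show False by (simp add: D_def)
  qed
  moreover have "(\<Sum>e\<in>B. \<Sum>f\<in>B. g p (?N e f) (?N e f)) \<ge> 0"
    by (intro sum_nonneg nonneg)
  ultimately show ?thesis
    unfolding norm_nabla_endo_def Let_def B_def[symmetric] by simp
qed

lemma sharp_lee: "sharp g p (lee p) = Psi p 0 (of_real (4 / s) * m p * w p)"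
proof (rule sharp_eqI)
  fix X
  have "g p (Psi p 0 (of_real (4 / s) * m p * w p)) X
     = s * Re (of_real (1 / s) * (4 * (m p * (m p * (cnj (w p) * mu p X)))))"
    unfolding g_def by (simp add: algebra_simps)
  also have "\<dots> = 4 * Re (m p * (m p * (cnj (w p) * mu p X)))"
    using s_pos by (simp del: of_real_divide)
  also have "\<dots> = lee p X"
    unfolding lee_def dnorm_eq m_eq by (simp add: algebra_simps)
  finally show "g p (Psi p 0 (of_real (4 / s) * m p * w p)) X = lee p X" .
qed (use bilinear_g g_pos in auto)

lemma lee_span:
  assumes "p \<in> U"
  shows "span {sharp g p (lee p), I p (sharp g p (lee p))} = D p"
proof -
  let ?c = "of_real (4 / s) * m p * w p"
  have "?c \<noteq> 0" using assms s_pos by (simp add: U_def)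
  moreover have "I p (Psi p 0 ?c) = Psi p 0 (\<i> * ?c)" by (simp add: cs_def)
  ultimately show ?thesis unfolding sharp_lee using span_vertical by metis
qed

lemma generalized_calabi: "generalized_calabi_type U g J D"
  unfolding generalized_calabi_type_def Let_def opposite_structure_J
  using kaehler_surface_J[OF open_U U_nonempty] qch_D[OF open_U] hermitian_cs[of "- 1" U]
    norm_nabla_I lee_I[of U] lee_span nabla_I_kernel
  by (intro conjI exI[of _ lee]) auto

section \<open>The conformal Kaehler metric\<close>

lemma F_der: "(F has_derivative (\<lambda>X. 2 * Re (dnorm p X))) (at p)"
proof -
  have F: "F = (\<lambda>p. Re (1 + 2 * w p * cnj (w p)))"
    by (simp add: of_real_F[symmetric])
  show ?thesis
    unfolding F
    by (rule has_derivative_eq_rhs, (rule derivative_intros w_der)+)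
       (auto simp: dnorm_def algebra_simps)
qed

lemma smooth_F: "smooth_on UNIV F"
proof -
  have F: "F = (\<lambda>p. Re (1 + 2 * w p * cnj (w p)))"
    by (simp add: of_real_F[symmetric])
  show ?thesis
    unfolding F by (intro smooth_on_compose_linear[OF bounded_linear_Re] smooth_intros linear_smooth)
qed

text \<open>The Lee form is \<open>d (ln F)\<close>, so multiplying the metric by \<open>exp (- 2 ln F)\<close> cancels the term
  \<open>2 \<theta> \<and> \<omega>\<^sub>I\<close>.  Orthogonality and integrability of \<open>I\<close> do not see conformal factors.\<close>

lemma conformal_kaehler: "kaehler S (\<lambda>q X Y. exp (- 2 * ln (F q)) * g q X Y) I"
proof -
  have e: "exp (- 2 * ln (F q)) = inverse (F q) * inverse (F q)" for q
    using F_pos[of q] by (simp add: exp_minus exp_double ln_inverse[symmetric] power2_eq_square)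
  let ?r = "\<lambda>q. inverse (F q) * inverse (F q)"
  let ?h = "\<lambda>q X Y. ?r q * g q X Y"
  have r: "?r q > 0" for q by simp
  have "smooth_on UNIV ?r" by (intro smooth_intros smooth_on_inverse smooth_F) simp_all
  then have "smooth_on UNIV (\<lambda>q. ?h q X Y)" for X Y by (rule smooth_on_mult[OF _ smooth_g])
  then have "smooth_on S (\<lambda>q. ?h q X Y)" for X Y by (rule smooth_on_subset) simp
  moreover have "bilinear (?h q)" for q
    using bilinear_g[of q] by (auto simp: bilinear_def linear_iff algebra_simps)
  ultimately have "riemannian_metric S ?h"
    unfolding riemannian_metric_def smooth_two_tensor_def
    using g_comm g_pos r by (auto simp: mult_pos_pos)
  then have herm: "hermitian S ?h I"
    using hermitian_cs[of "-1" S] unfolding hermitian_def almost_hermitian_def by simp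
  have r_der: "(?r has_derivative (\<lambda>X. - 2 * ?r p * lee p X)) (at p)" for p
  proof -
    have "lee p X = inverse (F p) * (2 * Re (dnorm p X))" for X
      by (simp add: lee_def m_eq inverse_eq_divide)
    then show ?thesis
      by (auto intro!: derivative_eq_intros F_der simp: algebra_simps)
  qed
  have "ext_deriv2 (kaehler_form ?h I) p X Y Z = 0" for p X Y Z
  proof -
    have kf: "kaehler_form ?h I = (\<lambda>q X Y. ?r q * kaehler_form g I q X Y)"
      by (simp add: kaehler_form_def fun_eq_iff)
    have fd: "frechet_derivative (\<lambda>q. ?r q * kaehler_form g I q Y Z) (at p) X =
        ?r p * frechet_derivative (\<lambda>q. kaehler_form g I q Y Z) (at p) X
        - 2 * ?r p * (lee p X * kaehler_form g I p Y Z)" for X Y Z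
      unfolding frechet_derivative_at[OF has_derivative_mult[OF r_der kaehler_form_der], symmetric]
        frechet_derivative_at[OF kaehler_form_der, symmetric] by simp
    have "ext_deriv2 (kaehler_form ?h I) p X Y Z = ?r p * (ext_deriv2 (kaehler_form g I) p X Y Z
        - 2 * wedge_1_2 (lee p) (kaehler_form g I p) X Y Z)"
      unfolding ext_deriv2_def kf fd wedge_1_2_def by (simp add: algebra_simps)
    also have "\<dots> = 0" using lee_I[of UNIV] unfolding lee_form_def by simp
    finally show ?thesis .
  qed
  then show ?thesis using herm unfolding kaehler_def e by blast
qed

lemma lck: "open S \<Longrightarrow> locally_conformally_kaehler S g I"
proof -
  have "smooth_on UNIV (\<lambda>q. - 2 * ln (F q))"
    by (intro smooth_intros smooth_on_ln smooth_F) simp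
  then have "smooth_on S (\<lambda>q. - 2 * ln (F q))" by (rule smooth_on_subset) simp
  moreover have "hermitian S g I" by (rule hermitian_cs) simp
  ultimately show "open S \<Longrightarrow> locally_conformally_kaehler S g I"
    unfolding locally_conformally_kaehler_def using conformal_kaehler[of S]
    by (intro conjI ballI exI[of _ S] exI[of _ "\<lambda>q. - 2 * ln (F q)"]) auto
qed

theorem calabi_type_g: "qch_of_calabi_type UNIV g J"
proof -
  have "calabi_type_kaehler_surface U g J"
    unfolding calabi_type_kaehler_surface_def
    using generalized_calabi lck[OF open_U] opposite_structure_J by metis
  then show ?thesis
    unfolding qch_of_calabi_type_def qch_kaehler_surface_def
    using open_U dense_U kaehler_surface_J[OF open_UNIV] qch_D[OF open_UNIV] by blast
qed

end

section \<open>The coordinate metric in polar coordinates\<close>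

lemma grad_prod_eq:
  assumes f: "(f has_derivative (\<lambda>X. A \<bullet> X)) (at p)" and h: "(h has_derivative (\<lambda>X. B \<bullet> X)) (at p)"
    and E: "E > 0" "\<And>X Y. g_Sigma \<alpha> \<beta> p X Y = E * (X \<bullet> Y)"
  shows "grad_prod \<alpha> \<beta> f h p = (A \<bullet> B) / E"
proof -
  have "bilinear (g_Sigma \<alpha> \<beta> p)"
    unfolding bilinear_def E(2) by (auto intro!: linearI simp: algebra_simps)
  then have sharp: "sharp (g_Sigma \<alpha> \<beta>) p (\<lambda>X. C \<bullet> X) = C /\<^sub>R E" for C
    using E by (intro sharp_eqI) auto
  show ?thesis
    unfolding grad_prod_def gradient_def frechet_derivative_at[OF f, symmetric]
      frechet_derivative_at[OF h, symmetric] sharp E(2) using E(1) by (simp add: field_simps)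
qed

context heisenberg_frame begin

text \<open>At a point with \<open>z = v e\<^sub>1\<close> and \<open>w = u e\<^sub>2\<close>, tangent vectors are given by their radial components
  \<open>x1, x2\<close> and angular velocities \<open>A, B\<close>.\<close>

lemma polar_eqs:
  assumes "cmod e1 = 1" "cmod e2 = 1" "z p = of_real v * e1" "w p = of_real u * e2"
    and "z X = (of_real x1 + \<i> * of_real (v * A)) * e1" "w X = (of_real x2 + \<i> * of_real (u * B)) * e2"
  shows "dnorm p X = of_real (2 * u * x2)" "tau p X = \<i> * of_real (2 * v\<^sup>2 * A)"
    "mu p X = (of_real (F p * x2) + \<i> * of_real (u * (B + 2 * v\<^sup>2 * A))) * e2"
    "F p = 1 + 2 * u\<^sup>2"
proof -
  have e: "cnj e1 * e1 = 1" "cnj e2 * e2 = 1" "e1 * cnj e1 = 1" "e2 * cnj e2 = 1"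
    using assms(1,2) by (simp_all add: complex_norm_square[symmetric] mult.commute)
  show F: "F p = 1 + 2 * u\<^sup>2" unfolding F_def assms(4) using assms(2) by (simp add: norm_mult)
  have ww: "cnj (w p) * w X = of_real u * (of_real x2 + \<i> * of_real (u * B)) * (cnj e2 * e2)"
    "w p * cnj (w X) = of_real u * (of_real x2 - \<i> * of_real (u * B)) * (e2 * cnj e2)"
    unfolding assms by (simp_all add: algebra_simps)
  show a: "dnorm p X = of_real (2 * u * x2)" unfolding dnorm_def ww e by (simp add: algebra_simps)
  have zz: "cnj (z p) * z X = of_real v * (of_real x1 + \<i> * of_real (v * A)) * (cnj e1 * e1)"
    "z p * cnj (z X) = of_real v * (of_real x1 - \<i> * of_real (v * A)) * (e1 * cnj e1)"
    unfolding assms by (simp_all add: algebra_simps)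
  show t: "tau p X = \<i> * of_real (2 * v\<^sup>2 * A)"
    unfolding tau_def zz e by (simp add: algebra_simps power2_eq_square)
  show "mu p X = (of_real (F p * x2) + \<i> * of_real (u * (B + 2 * v\<^sup>2 * A))) * e2"
    unfolding mu_def conn_eq a t F assms by (simp add: algebra_simps power2_eq_square)
qed

lemma
  assumes e: "cmod e1 = 1" "cmod e2 = 1" and p: "z p = of_real v * e1" "w p = of_real u * e2"
    and X: "z X = (of_real x1 + \<i> * of_real (v * A)) * e1" "w X = (of_real x2 + \<i> * of_real (u * B)) * e2"
    and Y: "z Y = (of_real y1 + \<i> * of_real (v * A')) * e1" "w Y = (of_real y2 + \<i> * of_real (u * B')) * e2"
  shows g_polar: "g p X Y = s * ((1 + 2 * u\<^sup>2) * (x1 * y1 + x2 * y2 + v\<^sup>2 * A * A')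
      + u\<^sup>2 * (B + 2 * v\<^sup>2 * A) * (B' + 2 * v\<^sup>2 * A') / (1 + 2 * u\<^sup>2))"
    and form_polar: "kaehler_form g J p X Y = s * ((1 + 2 * u\<^sup>2) * v * (x1 * A' - A * y1)
      + u * (x2 * B' - B * y2) + 2 * u * v\<^sup>2 * (x2 * A' - y2 * A))"
proof -
  have e': "cnj e1 * e1 = 1" "cnj e2 * e2 = 1"
    using e by (simp_all add: complex_norm_square[symmetric] mult.commute)
  have c: "cnj ((of_real a1 + \<i> * of_real b1) * e) * ((of_real a2 + \<i> * of_real b2) * e)
      = Complex (a1 * a2 + b1 * b2) (a1 * b2 - b1 * a2) * (cnj e * e)" for a1 b1 a2 b2 e
    by (simp add: complex_eq_iff algebra_simps)
  note PX = polar_eqs[OF e p X] and PY = polar_eqs[OF e p Y]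
  have F: "1 + 2 * u\<^sup>2 \<noteq> 0" using PX(4) F_nz by metis
  show "g p X Y = s * ((1 + 2 * u\<^sup>2) * (x1 * y1 + x2 * y2 + v\<^sup>2 * A * A')
      + u\<^sup>2 * (B + 2 * v\<^sup>2 * A) * (B' + 2 * v\<^sup>2 * A') / (1 + 2 * u\<^sup>2))"
    unfolding g_eq PX(3) PY(3) X(1) Y(1) c e' PX(4) using F
    by (simp add: field_simps power2_eq_square)
  have tt: "tau X Y = cnj (z X) * z Y - cnj (cnj (z X) * z Y)"
    and vv: "vform p X Y = cnj (w X) * w Y - cnj (cnj (w X) * w Y) + dnorm p X * tau p Y - dnorm p Y * tau p X"
    by (simp_all add: tau_def vform_def mult.commute)
  have t: "Im (tau X Y) = 2 * v * (x1 * A' - A * y1)"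
    and v: "Im (vform p X Y) = 2 * u * (x2 * B' - B * y2) + 4 * u * v\<^sup>2 * (x2 * A' - y2 * A)"
    unfolding tt vv X Y c e' PX(1,2) PY(1,2) by (simp_all add: algebra_simps)
  have im: "Im (of_real 1 * of_real (1 + 2 * u\<^sup>2) * x + y) = (1 + 2 * u\<^sup>2) * Im x + Im y" for x y
    by simp
  show "kaehler_form g J p X Y = s * ((1 + 2 * u\<^sup>2) * v * (x1 * A' - A * y1)
      + u * (x2 * B' - B * y2) + 2 * u * v\<^sup>2 * (x2 * A' - y2 * A))"
    unfolding kaehler_form_cs of_real_F[symmetric] PX(4) im t v by (simp add: algebra_simps)
qed

end

section \<open>Parabolic coordinates on the half plane\<close>

text \<open>The parabolic coordinates of the half plane are \<open>rad 1\<close> and \<open>rad (-1)\<close>, up to normalisation the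
  squares of the radii \<open>u\<close> and \<open>v\<close>.\<close>

definition rad :: "real \<Rightarrow> real \<times> real \<Rightarrow> real" where
  "rad \<epsilon> = (\<lambda>(x, y). sqrt (x\<^sup>2 + y\<^sup>2) + \<epsilon> * y)"

lemma rad_pos:
  assumes "x > 0" "\<epsilon> * \<epsilon> = 1"
  shows "rad \<epsilon> (x, y) > 0"
proof -
  have "\<epsilon> = 1 \<or> \<epsilon> = -1" using assms(2) by (metis square_eq_1_iff)
  moreover have "\<bar>y\<bar> < sqrt (x\<^sup>2 + y\<^sup>2)"
    by (rule real_less_rsqrt) (use assms in auto)
  ultimately show ?thesis by (auto simp: rad_def)
qed

text \<open>The map \<open>u + \<i> v \<mapsto> (u + \<i> v)\<^sup>2\<close> in real terms: \<open>2 M (\<epsilon> y + \<i> x) = (u + \<i> v)\<^sup>2\<close>.\<close>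

lemma polar_coords:
  fixes M \<epsilon> x y :: real
  assumes M: "M > 0" and e: "\<epsilon> * \<epsilon> = 1" and x: "x > 0"
  obtains u v where "u > 0" "v > 0" "sqrt (M * rad \<epsilon> (x, y)) = u" "sqrt (M * rad (- \<epsilon>) (x, y)) = v"
    "M * x = u * v" "2 * M * y = \<epsilon> * (u\<^sup>2 - v\<^sup>2)" "2 * M * sqrt (x\<^sup>2 + y\<^sup>2) = u\<^sup>2 + v\<^sup>2"
proof -
  define u where "u = sqrt (M * rad \<epsilon> (x, y))"
  define v where "v = sqrt (M * rad (- \<epsilon>) (x, y))"
  have pos: "rad \<epsilon> (x, y) > 0" "rad (- \<epsilon>) (x, y) > 0" using rad_pos x e by simp_all
  then have uv: "u > 0" "v > 0" using M by (simp_all add: u_def v_def)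
  have u2: "u\<^sup>2 = M * (sqrt (x\<^sup>2 + y\<^sup>2) + \<epsilon> * y)" and v2: "v\<^sup>2 = M * (sqrt (x\<^sup>2 + y\<^sup>2) - \<epsilon> * y)"
    using pos M by (simp_all add: u_def v_def rad_def)
  have "(u * v)\<^sup>2 = M\<^sup>2 * ((sqrt (x\<^sup>2 + y\<^sup>2))\<^sup>2 - (\<epsilon> * \<epsilon>) * y\<^sup>2)"
    unfolding power_mult_distrib u2 v2 by (simp add: algebra_simps power2_eq_square)
  also have "\<dots> = (M * x)\<^sup>2" unfolding e by (simp add: power_mult_distrib)
  finally have "M * x = u * v"
    using uv M x by (metis less_imp_le mult_pos_pos power2_eq_imp_eq)
  moreover have "2 * M * y = \<epsilon> * (u\<^sup>2 - v\<^sup>2)"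
  proof -
    have "\<epsilon> * (u\<^sup>2 - v\<^sup>2) = 2 * M * y * (\<epsilon> * \<epsilon>)"
      unfolding u2 v2 by (simp add: algebra_simps)
    then show ?thesis using e by simp
  qed
  moreover have "2 * M * sqrt (x\<^sup>2 + y\<^sup>2) = u\<^sup>2 + v\<^sup>2" unfolding u2 v2 by (simp add: algebra_simps)
  ultimately show ?thesis using that uv u_def v_def by blast
qed

lemma rad_der:
  assumes "x > 0"
  shows "(rad \<epsilon> has_derivative (\<lambda>X. (x * fst X + y * snd X) / sqrt (x\<^sup>2 + y\<^sup>2) + \<epsilon> * snd X)) (at (x, y))"
proof -
  have pos: "x\<^sup>2 + y\<^sup>2 > 0" using assms by (simp add: add_pos_nonneg)
  have "(\<lambda>p. sqrt ((fst p)\<^sup>2 + (snd p)\<^sup>2) + \<epsilon> * snd p) = rad \<epsilon>" by (auto simp: rad_def)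
  moreover have "((\<lambda>p. sqrt ((fst p)\<^sup>2 + (snd p)\<^sup>2) + \<epsilon> * snd p) has_derivative
     (\<lambda>X. (x * fst X + y * snd X) / sqrt (x\<^sup>2 + y\<^sup>2) + \<epsilon> * snd X)) (at (x, y))"
  proof -
    have D: "((\<lambda>p. (fst p)\<^sup>2 + (snd p)\<^sup>2) has_derivative (\<lambda>X. 2 * x * fst X + 2 * y * snd X)) (at (x, y))"
      by (auto intro!: derivative_eq_intros)
    have pos': "0 < (fst (x, y))\<^sup>2 + (snd (x, y))\<^sup>2" using pos by simp
    have half: "(a * (x * 2) + b * (y * 2)) / (2 * r) = (a * x + b * y) / r" for a b r :: real
      by (cases "r = 0") (simp_all add: field_simps)
    from has_derivative_add[OF has_derivative_real_sqrt[OF pos' D]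
        has_derivative_mult_right[OF has_derivative_snd[OF has_derivative_ident]], of \<epsilon>]
    show ?thesis
      by (rule has_derivative_eq_rhs) (simp add: fun_eq_iff field_simps half)
  qed
  ultimately show ?thesis by simp
qed

text \<open>The Euclidean gradient of \<open>u\<close>, from inverting \<open>M dx = u dv + v du\<close> and
  \<open>M dy = \<epsilon> (u du - v dv)\<close>.\<close>

definition grad_sqrt_rad :: "real \<Rightarrow> real \<Rightarrow> real \<Rightarrow> real \<Rightarrow> real \<times> real" where
  "grad_sqrt_rad M \<epsilon> u v = (M * v / (u\<^sup>2 + v\<^sup>2), \<epsilon> * M * u / (u\<^sup>2 + v\<^sup>2))"

lemma sqrt_rad_der:
  assumes M: "M > 0" and e: "\<epsilon> * \<epsilon> = 1" and x: "x > 0" and uv: "u > 0" "v > 0"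
    and u: "sqrt (M * rad \<epsilon> (x, y)) = u"
    and eqs: "M * x = u * v" "2 * M * y = \<epsilon> * (u\<^sup>2 - v\<^sup>2)" "2 * M * sqrt (x\<^sup>2 + y\<^sup>2) = u\<^sup>2 + v\<^sup>2"
  shows "(rad \<epsilon> has_derivative (\<lambda>X. 2 * u / M * (grad_sqrt_rad M \<epsilon> u v \<bullet> X))) (at (x, y))"
    and "((\<lambda>p. sqrt (M * rad \<epsilon> p)) has_derivative (\<lambda>X. grad_sqrt_rad M \<epsilon> u v \<bullet> X)) (at (x, y))"
proof -
  define N where "N = u\<^sup>2 + v\<^sup>2"
  have N: "N \<noteq> 0" using uv unfolding N_def by (metis add_pos_pos less_irrefl zero_less_power)
  have xyr: "x = u * v / M" "y = \<epsilon> * (u\<^sup>2 - v\<^sup>2) / (2 * M)" "sqrt (x\<^sup>2 + y\<^sup>2) = N / (2 * M)"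
    using eqs M by (simp_all add: field_simps N_def)
  have "(x * fst X + y * snd X) / sqrt (x\<^sup>2 + y\<^sup>2) + \<epsilon> * snd X = 2 * u / M * (grad_sqrt_rad M \<epsilon> u v \<bullet> X)" for X
  proof -
    have "x * fst X + y * snd X = (2 * u * v * fst X + \<epsilon> * (u\<^sup>2 - v\<^sup>2) * snd X) / (2 * M)"
      unfolding xyr(1) by (subst xyr(2)) (use M in \<open>simp add: field_simps\<close>)
    then have "(x * fst X + y * snd X) / sqrt (x\<^sup>2 + y\<^sup>2) + \<epsilon> * snd X
        = (2 * u * v * fst X + \<epsilon> * (u\<^sup>2 - v\<^sup>2) * snd X) / N + \<epsilon> * snd X * N / N"
      unfolding xyr(3) using M N by simp
    also have "\<dots> = 2 * u * (v * fst X + \<epsilon> * u * snd X) / N"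
      unfolding add_divide_distrib[symmetric] by (simp add: N_def algebra_simps power2_eq_square)
    also have "\<dots> = 2 * u / M * (grad_sqrt_rad M \<epsilon> u v \<bullet> X)"
      unfolding grad_sqrt_rad_def N_def[symmetric] inner_prod_def using M by (simp add: add_divide_distrib algebra_simps)
    finally show ?thesis .
  qed
  then show D: "(rad \<epsilon> has_derivative (\<lambda>X. 2 * u / M * (grad_sqrt_rad M \<epsilon> u v \<bullet> X))) (at (x, y))"
    using rad_der[OF x, of \<epsilon> y] by simp
  have pos: "M * rad \<epsilon> (x, y) > 0" using M rad_pos[OF x e] by simp
  show "((\<lambda>p. sqrt (M * rad \<epsilon> p)) has_derivative (\<lambda>X. grad_sqrt_rad M \<epsilon> u v \<bullet> X)) (at (x, y))"
    by (rule has_derivative_eq_rhs[OF has_derivative_real_sqrt[OF pos has_derivative_mult_right[OF D]]])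
      (use u uv M in \<open>auto simp: field_simps\<close>)
qed

lemma two_div_sqrt2: "2 * r / M * q / sqrt 2 = sqrt 2 / M * (r * q)" for M r q :: real
proof -
  have "2 / sqrt 2 = sqrt 2" by (simp add: real_div_sqrt)
  then show ?thesis
    by (metis (no_types, opaque_lifting) times_divide_eq_left times_divide_eq_right mult.commute mult.left_commute)
qed

text \<open>The data of an exceptional surface with the roles of the two indices made uniform: \<open>\<epsilon>\<close> is the
  value of \<open>k\<close>, and the suffixes \<open>z\<close> and \<open>w\<close> replace the indices 1 and 2 when \<open>\<epsilon> = 1\<close> and 2 and
  1 when \<open>\<epsilon> = -1\<close>.  The momentum of the \<open>z\<close>-angle carries the quadratic term; its coefficient is
  \<open>(\<alpha> + \<beta>) / 2 = \<surd>2 M\<close>.\<close>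

locale taub_nut_frame = heisenberg_frame z w vec "2 / M"
  for z w :: "complex \<times> complex \<Rightarrow> complex" and vec and M :: real +
  fixes \<alpha> \<beta> \<epsilon> :: real and az aw :: "real \<times> real \<Rightarrow> real" and tor :: "real \<Rightarrow> real \<Rightarrow> real \<times> real"
    and \<psi>z \<psi>w :: "real \<times> real \<Rightarrow> real"
  assumes eps: "\<epsilon> * \<epsilon> = 1" and M_pos: "M > 0" and tn_M: "tn_M \<alpha> \<beta> = M" and tn_k: "tn_k \<alpha> \<beta> = \<epsilon>"
    and bl_az: "bounded_linear az" and bl_aw: "bounded_linear aw"
    and az_tor [simp]: "az (tor r1 r2) = r1" and aw_tor [simp]: "aw (tor r1 r2) = r2"
    and tor_eq [simp]: "tor (az \<eta>) (aw \<eta>) = \<eta>"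
    and psi_z: "\<psi>z = (\<lambda>p. rad (- \<epsilon>) p / sqrt 2 + sqrt 2 * M * (fst p)\<^sup>2)"
    and psi_w: "\<psi>w = (\<lambda>p. rad \<epsilon> p / sqrt 2)"
    and coord_metric: "tn_coord_metric \<alpha> \<beta> (p, \<theta>) (X, \<eta>) (Y, \<zeta>) = g_Sigma \<alpha> \<beta> p X Y
        + grad_prod \<alpha> \<beta> \<psi>z \<psi>z p * az \<eta> * az \<zeta> + grad_prod \<alpha> \<beta> \<psi>z \<psi>w p * az \<eta> * aw \<zeta>
        + grad_prod \<alpha> \<beta> \<psi>w \<psi>z p * aw \<eta> * az \<zeta> + grad_prod \<alpha> \<beta> \<psi>w \<psi>w p * aw \<eta> * aw \<zeta>"
    and coord_omega: "tn_coord_omega \<alpha> \<beta> (p, \<theta>) (X, \<eta>) (Y, \<zeta>) =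
        frechet_derivative \<psi>z (at p) X * az \<zeta> - frechet_derivative \<psi>z (at p) Y * az \<eta>
      + frechet_derivative \<psi>w (at p) X * aw \<zeta> - frechet_derivative \<psi>w (at p) Y * aw \<eta>"
    and chart: "tn_chart \<alpha> \<beta> (p, \<theta>) = vec (complex_of_real (sqrt (M * rad (- \<epsilon>) p)) * cis (az \<theta> / sqrt 2))
        (complex_of_real (sqrt (M * rad \<epsilon> p)) * cis (aw \<theta> / sqrt 2))"
begin

definition uu :: "real \<times> real \<Rightarrow> real" where "uu p = sqrt (M * rad \<epsilon> p)"
definition vv :: "real \<times> real \<Rightarrow> real" where "vv p = sqrt (M * rad (- \<epsilon>) p)"

definition grad_u :: "real \<times> real \<Rightarrow> real \<times> real" where "grad_u p = grad_sqrt_rad M \<epsilon> (uu p) (vv p)"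
definition grad_v :: "real \<times> real \<Rightarrow> real \<times> real" where "grad_v p = grad_sqrt_rad M (- \<epsilon>) (vv p) (uu p)"

context
  fixes p :: "real \<times> real"
  assumes p_pos: "fst p > 0"
begin

lemma uv_facts: "uu p > 0" "vv p > 0" "M * fst p = uu p * vv p"
    "2 * M * snd p = \<epsilon> * ((uu p)\<^sup>2 - (vv p)\<^sup>2)"
    "2 * M * sqrt ((fst p)\<^sup>2 + (snd p)\<^sup>2) = (uu p)\<^sup>2 + (vv p)\<^sup>2"
proof -
  obtain u v where "u > 0" "v > 0" "sqrt (M * rad \<epsilon> p) = u" "sqrt (M * rad (- \<epsilon>) p) = v"
    "M * fst p = u * v" "2 * M * snd p = \<epsilon> * (u\<^sup>2 - v\<^sup>2)"
    "2 * M * sqrt ((fst p)\<^sup>2 + (snd p)\<^sup>2) = u\<^sup>2 + v\<^sup>2"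
    by (rule polar_coords[OF M_pos eps p_pos, of "snd p"]) (simp only: prod.collapse)
  then show "uu p > 0" "vv p > 0" "M * fst p = uu p * vv p"
    "2 * M * snd p = \<epsilon> * ((uu p)\<^sup>2 - (vv p)\<^sup>2)"
    "2 * M * sqrt ((fst p)\<^sup>2 + (snd p)\<^sup>2) = (uu p)\<^sup>2 + (vv p)\<^sup>2"
    unfolding uu_def vv_def by simp_all
qed

lemma uv_der:
  "(rad \<epsilon> has_derivative (\<lambda>X. 2 * uu p / M * (grad_u p \<bullet> X))) (at p)"
  "(uu has_derivative (\<lambda>X. grad_u p \<bullet> X)) (at p)"
  "(rad (- \<epsilon>) has_derivative (\<lambda>X. 2 * vv p / M * (grad_v p \<bullet> X))) (at p)"
  "(vv has_derivative (\<lambda>X. grad_v p \<bullet> X)) (at p)"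
proof -
  note u = sqrt_rad_der[where x = "fst p" and y = "snd p", OF M_pos eps p_pos uv_facts(1,2) _ uv_facts(3-5)]
  show "(rad \<epsilon> has_derivative (\<lambda>X. 2 * uu p / M * (grad_u p \<bullet> X))) (at p)"
    "(uu has_derivative (\<lambda>X. grad_u p \<bullet> X)) (at p)"
    using u unfolding grad_u_def uu_def[abs_def] vv_def by auto
  have e: "(- \<epsilon>) * (- \<epsilon>) = 1" using eps by simp
  have f: "M * fst p = vv p * uu p" "2 * M * snd p = (- \<epsilon>) * ((vv p)\<^sup>2 - (uu p)\<^sup>2)"
    "2 * M * sqrt ((fst p)\<^sup>2 + (snd p)\<^sup>2) = (vv p)\<^sup>2 + (uu p)\<^sup>2"
    using uv_facts(3-5) by (simp_all add: algebra_simps)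
  note v = sqrt_rad_der[where x = "fst p" and y = "snd p", OF M_pos e p_pos uv_facts(2,1) _ f]
  show "(rad (- \<epsilon>) has_derivative (\<lambda>X. 2 * vv p / M * (grad_v p \<bullet> X))) (at p)"
    "(vv has_derivative (\<lambda>X. grad_v p \<bullet> X)) (at p)"
    using v unfolding grad_v_def vv_def[abs_def] uu_def by auto
qed

lemma N_pos: "(uu p)\<^sup>2 + (vv p)\<^sup>2 > 0"
  using uv_facts(1) by (simp add: add_pos_nonneg)

lemma N_nz: "(uu p)\<^sup>2 + (vv p)\<^sup>2 \<noteq> 0"
  using N_pos by (metis less_irrefl)

lemma grad_uv_eq:
  "grad_u p = (M * vv p / ((uu p)\<^sup>2 + (vv p)\<^sup>2), \<epsilon> * M * uu p / ((uu p)\<^sup>2 + (vv p)\<^sup>2))"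
  "grad_v p = (M * uu p / ((uu p)\<^sup>2 + (vv p)\<^sup>2), - \<epsilon> * M * vv p / ((uu p)\<^sup>2 + (vv p)\<^sup>2))"
  by (simp_all only: grad_u_def grad_v_def grad_sqrt_rad_def add.commute)

text \<open>The map from \<open>(u, v)\<close> to \<open>(x, y)\<close> is conformal, so the gradients of \<open>u\<close> and \<open>v\<close> are
  orthogonal and of equal length.\<close>

lemma grad_uv_inner:
  "grad_u p \<bullet> grad_u p = M\<^sup>2 / ((uu p)\<^sup>2 + (vv p)\<^sup>2)" "grad_v p \<bullet> grad_v p = M\<^sup>2 / ((uu p)\<^sup>2 + (vv p)\<^sup>2)"
  "grad_u p \<bullet> grad_v p = 0" "grad_v p \<bullet> grad_u p = 0"
proof -
  define u v N where "u = uu p" and "v = vv p" and "N = u\<^sup>2 + v\<^sup>2"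
  have N: "N \<noteq> 0" "N = u\<^sup>2 + v\<^sup>2" using N_nz by (simp_all add: u_def v_def N_def)
  note U = grad_uv_eq(1)[folded u_def v_def, folded N_def] and V = grad_uv_eq(2)[folded u_def v_def, folded N_def]
  have inn: "grad_u p \<bullet> grad_u p = (M\<^sup>2 * v\<^sup>2 + (\<epsilon> * \<epsilon>) * M\<^sup>2 * u\<^sup>2) / (N * N)"
    "grad_v p \<bullet> grad_v p = (M\<^sup>2 * u\<^sup>2 + (\<epsilon> * \<epsilon>) * M\<^sup>2 * v\<^sup>2) / (N * N)"
    "grad_u p \<bullet> grad_v p = (M\<^sup>2 * u * v - (\<epsilon> * \<epsilon>) * M\<^sup>2 * u * v) / (N * N)"
    unfolding U V by (simp_all add: inner_prod_def power2_eq_square add_divide_distrib diff_divide_distrib mult_ac)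
  have nn: "M\<^sup>2 * v\<^sup>2 + 1 * M\<^sup>2 * u\<^sup>2 = M\<^sup>2 * N" "M\<^sup>2 * u\<^sup>2 + 1 * M\<^sup>2 * v\<^sup>2 = M\<^sup>2 * N"
    by (simp_all add: N(2) algebra_simps)
  have "grad_u p \<bullet> grad_u p = M\<^sup>2 / N" "grad_v p \<bullet> grad_v p = M\<^sup>2 / N" "grad_u p \<bullet> grad_v p = 0"
    unfolding inn eps nn using N(1) by simp_all
  then show "grad_u p \<bullet> grad_u p = M\<^sup>2 / ((uu p)\<^sup>2 + (vv p)\<^sup>2)" "grad_v p \<bullet> grad_v p = M\<^sup>2 / ((uu p)\<^sup>2 + (vv p)\<^sup>2)"
    "grad_u p \<bullet> grad_v p = 0" "grad_v p \<bullet> grad_u p = 0"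
    by (simp_all only: u_def v_def N_def inner_commute)
qed

lemma fst_grad_uv: "M * fst X = uu p * (grad_v p \<bullet> X) + vv p * (grad_u p \<bullet> X)"
proof -
  define u v N where "u = uu p" and "v = vv p" and "N = u\<^sup>2 + v\<^sup>2"
  have N: "N \<noteq> 0" "N = u\<^sup>2 + v\<^sup>2" using N_nz by (simp_all add: u_def v_def N_def)
  note U = grad_uv_eq(1)[folded u_def v_def, folded N_def] and V = grad_uv_eq(2)[folded u_def v_def, folded N_def]
  have "u * (grad_v p \<bullet> X) + v * (grad_u p \<bullet> X) = M * fst X * (u\<^sup>2 + v\<^sup>2) / N"
    unfolding U V by (simp add: inner_prod_def power2_eq_square add_divide_distrib algebra_simps)
  then have "u * (grad_v p \<bullet> X) + v * (grad_u p \<bullet> X) = M * fst X"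
    unfolding N(2)[symmetric] using N(1) by simp
  then show ?thesis by (simp add: u_def v_def)
qed

lemma grad_uv_surj: "\<exists>X. grad_u p \<bullet> X = r1 \<and> grad_v p \<bullet> X = r2"
proof -
  define K where "K = ((uu p)\<^sup>2 + (vv p)\<^sup>2) / M\<^sup>2"
  have K: "K * (M\<^sup>2 / ((uu p)\<^sup>2 + (vv p)\<^sup>2)) = 1" using N_nz M_pos unfolding K_def by (simp del: sum_power2_eq_zero_iff)
  have "grad_u p \<bullet> ((r1 * K) *\<^sub>R grad_u p + (r2 * K) *\<^sub>R grad_v p) = r1"
    "grad_v p \<bullet> ((r1 * K) *\<^sub>R grad_u p + (r2 * K) *\<^sub>R grad_v p) = r2"
    unfolding inner_add_right inner_scaleR_right grad_uv_inner by (simp_all only: mult.assoc K mult_1_right mult_zero_right add_0_right add_0_left)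
  then show ?thesis by blast
qed

lemma inner_grad_uv:
  "X \<bullet> Y = ((uu p)\<^sup>2 + (vv p)\<^sup>2) / M\<^sup>2 * ((grad_u p \<bullet> X) * (grad_u p \<bullet> Y) + (grad_v p \<bullet> X) * (grad_v p \<bullet> Y))"
proof -
  define u v N where "u = uu p" and "v = vv p" and "N = u\<^sup>2 + v\<^sup>2"
  have N: "N \<noteq> 0" "N = u\<^sup>2 + v\<^sup>2" using N_nz by (simp_all add: u_def v_def N_def)
  note U = grad_uv_eq(1)[folded u_def v_def, folded N_def] and V = grad_uv_eq(2)[folded u_def v_def, folded N_def]
  have UX: "grad_u p \<bullet> X = M / N * (v * fst X + \<epsilon> * u * snd X)" "grad_v p \<bullet> X = M / N * (u * fst X - \<epsilon> * v * snd X)" for X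
    unfolding U V by (simp_all add: inner_prod_def add_divide_distrib algebra_simps)
  have "(v * fst X + \<epsilon> * u * snd X) * (v * fst Y + \<epsilon> * u * snd Y)
      + (u * fst X - \<epsilon> * v * snd X) * (u * fst Y - \<epsilon> * v * snd Y) = N * (X \<bullet> Y)"
    using eps unfolding N(2) inner_prod_def inner_real_def by algebra
  then have "(grad_u p \<bullet> X) * (grad_u p \<bullet> Y) + (grad_v p \<bullet> X) * (grad_v p \<bullet> Y) = M\<^sup>2 / N\<^sup>2 * (N * (X \<bullet> Y))"
    unfolding UX by (metis (no_types, opaque_lifting) mult.assoc mult.left_commute distrib_left power2_eq_square times_divide_times_eq)
  then show ?thesis
    using N M_pos unfolding u_def[symmetric] v_def[symmetric] N(2)[symmetric] by (simp add: power2_eq_square)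
qed

abbreviation "conf_factor \<equiv> 2 * M * (1 + 2 * (uu p)\<^sup>2) / ((uu p)\<^sup>2 + (vv p)\<^sup>2)"

lemma conf_factor_pos: "conf_factor > 0"
  using N_pos M_pos by (intro divide_pos_pos mult_pos_pos) (auto simp: add_pos_nonneg)

text \<open>The parameters satisfy \<open>M (k y + r) = u\<^sup>2\<close>, which turns the numerator of the conformal factor
  into \<open>F\<close>.\<close>

lemma g_Sigma_eq: "g_Sigma \<alpha> \<beta> p X Y = conf_factor * (X \<bullet> Y)"
proof -
  let ?r = "sqrt ((fst p)\<^sup>2 + (snd p)\<^sup>2)"
  have r: "?r = ((uu p)\<^sup>2 + (vv p)\<^sup>2) / (2 * M)" using uv_facts(5) M_pos by (simp add: field_simps)
  have "\<epsilon> * (2 * M * snd p) = (\<epsilon> * \<epsilon>) * ((uu p)\<^sup>2 - (vv p)\<^sup>2)" using uv_facts(4) by simp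
  then have "2 * M * (\<epsilon> * snd p + ?r) = 2 * (uu p)\<^sup>2"
    unfolding eps using uv_facts(5) by (simp add: distrib_left mult_ac)
  then have "g_Sigma \<alpha> \<beta> p X Y = (1 + 2 * (uu p)\<^sup>2) / ?r * (X \<bullet> Y)"
    unfolding g_Sigma_def tn_M tn_k by (simp add: case_prod_beta)
  then show ?thesis unfolding r using M_pos by (simp add: mult_ac)
qed

lemma psi_w_der: "(\<psi>w has_derivative (\<lambda>X. ((sqrt 2 * uu p / M) *\<^sub>R grad_u p) \<bullet> X)) (at p)"
  unfolding psi_w
  by (rule has_derivative_eq_rhs[OF bounded_linear.has_derivative[OF bounded_linear_divide uv_der(1)]])
     (simp only: fun_eq_iff two_div_sqrt2, simp)

text \<open>In the radii, \<open>\<psi>w = u\<^sup>2 / (\<surd>2 M)\<close> and \<open>\<psi>z = v\<^sup>2 (1 + 2 u\<^sup>2) / (\<surd>2 M)\<close>.\<close>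

lemma psi_z_der: "(\<psi>z has_derivative (\<lambda>X. ((sqrt 2 / M) *\<^sub>R
    ((vv p * (1 + 2 * (uu p)\<^sup>2)) *\<^sub>R grad_v p + (2 * uu p * (vv p)\<^sup>2) *\<^sub>R grad_u p)) \<bullet> X)) (at p)"
proof -
  have D: "((\<lambda>p. sqrt 2 * M * (fst p)\<^sup>2) has_derivative (\<lambda>X. sqrt 2 * M * (2 * fst p * fst X))) (at p)"
    by (auto intro!: derivative_eq_intros)
  have "M * (2 * fst p * fst X) = 2 / M * (uu p * vv p * (uu p * (grad_v p \<bullet> X) + vv p * (grad_u p \<bullet> X)))" for X
  proof -
    have "M * (2 * fst p * fst X) = 2 / M * ((M * fst p) * (M * fst X))" using M_pos by simp
    then show ?thesis unfolding uv_facts(3) fst_grad_uv[of X] .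
  qed
  then have *: "sqrt 2 * M * (2 * fst p * fst X) = sqrt 2 / M * (2 * (uu p)\<^sup>2 * vv p * (grad_v p \<bullet> X) + 2 * uu p * (vv p)\<^sup>2 * (grad_u p \<bullet> X))" for X
    unfolding mult.assoc[of "sqrt 2"] by (simp add: power2_eq_square algebra_simps)
  show ?thesis
    unfolding psi_z
    by (rule has_derivative_eq_rhs[OF has_derivative_add[OF bounded_linear.has_derivative[OF bounded_linear_divide uv_der(3)] D]])
       (simp only: fun_eq_iff * two_div_sqrt2, simp add: inner_add_left algebra_simps)
qed

end

end

context taub_nut_frame begin

section \<open>The chart and the extended structure\<close>

definition dchart :: "tn_coord \<Rightarrow> tn_coord \<Rightarrow> complex \<times> complex" where
  "dchart q X = vec
     ((of_real (grad_v (fst q) \<bullet> fst X) + \<i> * of_real (vv (fst q) * (az (snd X) / sqrt 2))) * cis (az (snd q) / sqrt 2))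
     ((of_real (grad_u (fst q) \<bullet> fst X) + \<i> * of_real (uu (fst q) * (aw (snd X) / sqrt 2))) * cis (aw (snd q) / sqrt 2))"

abbreviation "tnc \<equiv> tn_chart \<alpha> \<beta>"

lemma chart_eq: "tnc q = vec (of_real (vv (fst q)) * cis (az (snd q) / sqrt 2))
    (of_real (uu (fst q)) * cis (aw (snd q) / sqrt 2))"
  by (cases q) (simp add: chart uu_def vv_def)

lemma dom_iff: "q \<in> tn_coord_dom \<longleftrightarrow> fst (fst q) > 0"
  by (cases q) (auto simp: tn_coord_dom_def)

lemma angle_der:
  assumes "bounded_linear f"
  shows "((\<lambda>q. cis (f (snd q) / sqrt 2)) has_derivative
    (\<lambda>X. \<i> * of_real (f (snd X) / sqrt 2) * cis (f (snd q) / sqrt 2))) (at q)"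
proof -
  have "((\<lambda>q. f (snd q) / sqrt 2) has_derivative (\<lambda>X. f (snd X) / sqrt 2)) (at q)"
    by (rule bounded_linear.has_derivative[OF bounded_linear_divide
          bounded_linear.has_derivative[OF assms has_derivative_snd[OF has_derivative_ident]]])
  from has_derivative_cis[OF this] show ?thesis
    by (rule has_derivative_eq_rhs) (simp add: fun_eq_iff scaleR_conv_of_real mult_ac)
qed

lemma chart_der:
  assumes "fst (fst q) > 0"
  shows "(tnc has_derivative dchart q) (at q)"
proof -
  have U: "((\<lambda>q. uu (fst q)) has_derivative (\<lambda>X. grad_u (fst q) \<bullet> fst X)) (at q)"
    and V: "((\<lambda>q. vv (fst q)) has_derivative (\<lambda>X. grad_v (fst q) \<bullet> fst X)) (at q)"
    using has_derivative_compose[OF has_derivative_fst[OF has_derivative_ident] uv_der(2)[OF assms]]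
      has_derivative_compose[OF has_derivative_fst[OF has_derivative_ident] uv_der(4)[OF assms]] .
  have "(tnc has_derivative (\<lambda>X. vec
      (of_real (vv (fst q)) * (\<i> * of_real (az (snd X) / sqrt 2) * cis (az (snd q) / sqrt 2))
        + of_real (grad_v (fst q) \<bullet> fst X) * cis (az (snd q) / sqrt 2))
      (of_real (uu (fst q)) * (\<i> * of_real (aw (snd X) / sqrt 2) * cis (aw (snd q) / sqrt 2))
        + of_real (grad_u (fst q) \<bullet> fst X) * cis (aw (snd q) / sqrt 2)))) (at q)"
    unfolding chart_eq[abs_def]
    by (rule vec_der has_derivative_mult has_derivative_of_real U V angle_der bl_az bl_aw)+
  then show ?thesis
    by (rule has_derivative_eq_rhs) (simp add: dchart_def fun_eq_iff algebra_simps)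
qed

lemma chart_deriv_eq: "fst (fst q) > 0 \<Longrightarrow> tn_chart_deriv \<alpha> \<beta> q = dchart q"
  by (rule frechet_derivative_at[OF chart_der, symmetric])

lemma grad_prods:
  assumes p: "fst p > 0"
  shows "grad_prod \<alpha> \<beta> \<psi>w \<psi>w p = (uu p)\<^sup>2 / (M * (1 + 2 * (uu p)\<^sup>2))"
    "grad_prod \<alpha> \<beta> \<psi>z \<psi>w p = 2 * (uu p)\<^sup>2 * (vv p)\<^sup>2 / (M * (1 + 2 * (uu p)\<^sup>2))"
    "grad_prod \<alpha> \<beta> \<psi>w \<psi>z p = 2 * (uu p)\<^sup>2 * (vv p)\<^sup>2 / (M * (1 + 2 * (uu p)\<^sup>2))"
    "grad_prod \<alpha> \<beta> \<psi>z \<psi>z p = ((vv p)\<^sup>2 * (1 + 2 * (uu p)\<^sup>2)\<^sup>2 + 4 * (uu p)\<^sup>2 * (vv p)^4) / (M * (1 + 2 * (uu p)\<^sup>2))"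
proof -
  define N where "N = (uu p)\<^sup>2 + (vv p)\<^sup>2"
  define F where "F = 1 + 2 * (uu p)\<^sup>2"
  have quot: "(sqrt 2 / M * (sqrt 2 / M * (k * (M\<^sup>2 / N)))) / (2 * M * F / N) = k / (M * F)" for k
  proof -
    have "N \<noteq> 0" "F \<noteq> 0" using N_pos[OF p] by (auto simp: N_def F_def add_nonneg_eq_0_iff)
    moreover have "sqrt 2 / M * (sqrt 2 / M * (k * (M\<^sup>2 / N))) = 2 * k / N"
      using M_pos by (simp add: power2_eq_square)
    ultimately show ?thesis using M_pos by simp
  qed
  note W = psi_w_der[OF p] and Z = psi_z_der[OF p]
  note G = grad_prod_eq[OF _ _ conf_factor_pos[OF p] g_Sigma_eq[OF p]]
  note inner = inner_add_left inner_add_right inner_scaleR_left inner_scaleR_right grad_uv_inner[OF p]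
  note folds = N_def[symmetric] F_def[symmetric]
  show "grad_prod \<alpha> \<beta> \<psi>w \<psi>w p = (uu p)\<^sup>2 / (M * (1 + 2 * (uu p)\<^sup>2))"
    unfolding G[OF W W] inner folds quot[symmetric] by (simp add: power2_eq_square)
  show "grad_prod \<alpha> \<beta> \<psi>z \<psi>w p = 2 * (uu p)\<^sup>2 * (vv p)\<^sup>2 / (M * (1 + 2 * (uu p)\<^sup>2))"
    unfolding G[OF Z W] inner folds quot[symmetric] by (simp add: power2_eq_square)
  show "grad_prod \<alpha> \<beta> \<psi>w \<psi>z p = 2 * (uu p)\<^sup>2 * (vv p)\<^sup>2 / (M * (1 + 2 * (uu p)\<^sup>2))"
    unfolding G[OF W Z] inner folds quot[symmetric] by (simp add: power2_eq_square)
  show "grad_prod \<alpha> \<beta> \<psi>z \<psi>z p = ((vv p)\<^sup>2 * (1 + 2 * (uu p)\<^sup>2)\<^sup>2 + 4 * (uu p)\<^sup>2 * (vv p)^4) / (M * (1 + 2 * (uu p)\<^sup>2))"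
    unfolding G[OF Z Z] inner folds quot[symmetric]
    by (rule arg_cong[where f = "\<lambda>x. x / (2 * M * F / N)"]) (simp add: power2_eq_square power4_eq_xxxx algebra_simps)
qed

lemma frame_chart:
  "z (tnc q) = of_real (vv (fst q)) * cis (az (snd q) / sqrt 2)"
  "w (tnc q) = of_real (uu (fst q)) * cis (aw (snd q) / sqrt 2)"
  "z (dchart q X) = (of_real (grad_v (fst q) \<bullet> fst X) + \<i> * of_real (vv (fst q) * (az (snd X) / sqrt 2))) * cis (az (snd q) / sqrt 2)"
  "w (dchart q X) = (of_real (grad_u (fst q) \<bullet> fst X) + \<i> * of_real (uu (fst q) * (aw (snd X) / sqrt 2))) * cis (aw (snd q) / sqrt 2)"
  by (simp_all add: chart_eq dchart_def)

text \<open>Both sides are weighted sums of squares of \<open>du\<close>, \<open>dv\<close> and of the angular forms \<open>d\<phi>z\<close> and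
  \<open>d\<phi>w + 2 v\<^sup>2 d\<phi>z\<close>, with angles \<open>\<phi> = \<theta> / \<surd>2\<close>.\<close>

lemma metric_pullback:
  assumes p: "fst (fst q) > 0"
  shows "g (tnc q) (dchart q X) (dchart q Y) = tn_coord_metric \<alpha> \<beta> q X Y"
proof -
  define P where "P = fst q"
  have P: "fst P > 0" using p by (simp add: P_def)
  define u v F N where "u = uu P" and "v = vv P" and "F = 1 + 2 * u\<^sup>2" and "N = u\<^sup>2 + v\<^sup>2"
  have nz: "N \<noteq> 0" "F \<noteq> 0" "M \<noteq> 0"
    using N_pos[OF P] M_pos by (auto simp: N_def F_def u_def v_def add_nonneg_eq_0_iff)
  define A B A' B' where "A = az (snd X) / sqrt 2" and "B = aw (snd X) / sqrt 2"
    and "A' = az (snd Y) / sqrt 2" and "B' = aw (snd Y) / sqrt 2"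
  have ang: "az (snd X) = sqrt 2 * A" "aw (snd X) = sqrt 2 * B" "az (snd Y) = sqrt 2 * A'" "aw (snd Y) = sqrt 2 * B'"
    by (simp_all add: A_def B_def A'_def B'_def)
  define x1 x2 y1 y2 where "x1 = grad_v P \<bullet> fst X" and "x2 = grad_u P \<bullet> fst X" and "y1 = grad_v P \<bullet> fst Y" and "y2 = grad_u P \<bullet> fst Y"
  have 1: "g (tnc q) (dchart q X) (dchart q Y) = 2 / M * (F * (x1 * y1 + x2 * y2 + v\<^sup>2 * A * A')
      + u\<^sup>2 * (B + 2 * v\<^sup>2 * A) * (B' + 2 * v\<^sup>2 * A') / F)"
    using g_polar[OF norm_cis norm_cis frame_chart(1,2)[of q] frame_chart(3,4)[of q X] frame_chart(3,4)[of q Y]]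
    unfolding P_def u_def v_def F_def A_def B_def A'_def B'_def x1_def x2_def y1_def y2_def .
  have two: "k * (sqrt 2 * a1) * (sqrt 2 * a2) = k * (2 * a1 * a2)" for k a1 a2 :: real by simp
  have S: "g_Sigma \<alpha> \<beta> P (fst X) (fst Y) = 2 * F / M * (x1 * y1 + x2 * y2)"
  proof -
    have "g_Sigma \<alpha> \<beta> P (fst X) (fst Y) = 2 * M * F / N * (N / M\<^sup>2 * (x2 * y2 + x1 * y1))"
      unfolding g_Sigma_eq[OF P] inner_grad_uv[OF P, of "fst X"] u_def v_def F_def N_def x1_def x2_def y1_def y2_def ..
    then show ?thesis using nz by (simp add: power2_eq_square add.commute)
  qed
  have "tn_coord_metric \<alpha> \<beta> q X Y = g_Sigma \<alpha> \<beta> P (fst X) (fst Y)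
     + grad_prod \<alpha> \<beta> \<psi>z \<psi>z P * az (snd X) * az (snd Y) + grad_prod \<alpha> \<beta> \<psi>z \<psi>w P * az (snd X) * aw (snd Y)
     + grad_prod \<alpha> \<beta> \<psi>w \<psi>z P * aw (snd X) * az (snd Y) + grad_prod \<alpha> \<beta> \<psi>w \<psi>w P * aw (snd X) * aw (snd Y)"
    using coord_metric[of P "snd q" "fst X" "snd X" "fst Y" "snd Y"] by (simp add: P_def)
  also have "\<dots> = 2 * F / M * (x1 * y1 + x2 * y2)
    + (v\<^sup>2 * F\<^sup>2 + 4 * u\<^sup>2 * v^4) / (M * F) * (2 * A * A') + 2 * u\<^sup>2 * v\<^sup>2 / (M * F) * (2 * A * B')
    + 2 * u\<^sup>2 * v\<^sup>2 / (M * F) * (2 * B * A') + u\<^sup>2 / (M * F) * (2 * B * B')"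
    unfolding S grad_prods[OF P] ang two u_def[symmetric] v_def[symmetric] F_def[symmetric] ..
  also have "\<dots> = 2 / M * (F * (x1 * y1 + x2 * y2 + v\<^sup>2 * A * A')
      + u\<^sup>2 * (B + 2 * v\<^sup>2 * A) * (B' + 2 * v\<^sup>2 * A') / F)"
    using nz by (simp add: field_simps power2_eq_square power4_eq_xxxx)
  finally show ?thesis using 1 by simp
qed

lemma form_pullback:
  assumes p: "fst (fst q) > 0"
  shows "kaehler_form g J (tnc q) (dchart q X) (dchart q Y) = tn_coord_omega \<alpha> \<beta> q X Y"
proof -
  define P where "P = fst q"
  have P: "fst P > 0" using p by (simp add: P_def)
  define u v F where "u = uu P" and "v = vv P" and "F = 1 + 2 * u\<^sup>2"
  define A B A' B' where "A = az (snd X) / sqrt 2" and "B = aw (snd X) / sqrt 2"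
    and "A' = az (snd Y) / sqrt 2" and "B' = aw (snd Y) / sqrt 2"
  have ang: "az (snd X) = sqrt 2 * A" "aw (snd X) = sqrt 2 * B" "az (snd Y) = sqrt 2 * A'" "aw (snd Y) = sqrt 2 * B'"
    by (simp_all add: A_def B_def A'_def B'_def)
  define x1 x2 y1 y2 where "x1 = grad_v P \<bullet> fst X" and "x2 = grad_u P \<bullet> fst X" and "y1 = grad_v P \<bullet> fst Y" and "y2 = grad_u P \<bullet> fst Y"
  have 1: "kaehler_form g J (tnc q) (dchart q X) (dchart q Y) = 2 / M * (F * v * (x1 * A' - A * y1)
      + u * (x2 * B' - B * y2) + 2 * u * v\<^sup>2 * (x2 * A' - y2 * A))"
    using form_polar[OF norm_cis norm_cis frame_chart(1,2)[of q] frame_chart(3,4)[of q X] frame_chart(3,4)[of q Y]]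
    unfolding P_def u_def v_def F_def A_def B_def A'_def B'_def x1_def x2_def y1_def y2_def .
  have "tn_coord_omega \<alpha> \<beta> q X Y =
     frechet_derivative \<psi>z (at P) (fst X) * az (snd Y) - frechet_derivative \<psi>z (at P) (fst Y) * az (snd X)
      + frechet_derivative \<psi>w (at P) (fst X) * aw (snd Y) - frechet_derivative \<psi>w (at P) (fst Y) * aw (snd X)"
    using coord_omega[of P "snd q" "fst X" "snd X" "fst Y" "snd Y"] by (simp add: P_def)
  also have "\<dots> = sqrt 2 / M * (v * F * x1 + 2 * u * v\<^sup>2 * x2) * (sqrt 2 * A')
      - sqrt 2 / M * (v * F * y1 + 2 * u * v\<^sup>2 * y2) * (sqrt 2 * A)
      + sqrt 2 * u / M * x2 * (sqrt 2 * B') - sqrt 2 * u / M * y2 * (sqrt 2 * B)"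
    unfolding frechet_derivative_at[OF psi_z_der[OF P], symmetric] frechet_derivative_at[OF psi_w_der[OF P], symmetric]
      inner_add_left inner_scaleR_left ang x1_def x2_def y1_def y2_def u_def v_def F_def ..
  also have "\<dots> = 2 / M * (F * v * (x1 * A' - A * y1) + u * (x2 * B' - B * y2) + 2 * u * v\<^sup>2 * (x2 * A' - y2 * A))"
  proof -
    have two: "sqrt 2 / M * r1 * (sqrt 2 * r2) = 2 / M * (r1 * r2)"
      "sqrt 2 * u / M * r1 * (sqrt 2 * r2) = 2 / M * (u * r1 * r2)" for r1 r2 by simp_all
    show ?thesis unfolding two by (simp add: algebra_simps)
  qed
  finally show ?thesis using 1 by simp
qed

lemma dchart_surj:
  assumes p: "fst (fst q) > 0"
  shows "\<exists>X. dchart q X = W"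
proof -
  define r where "r = z W * cis (- (az (snd q) / sqrt 2))"
  define k where "k = w W * cis (- (aw (snd q) / sqrt 2))"
  obtain X where X: "grad_u (fst q) \<bullet> X = Re k" "grad_v (fst q) \<bullet> X = Re r" using grad_uv_surj[OF p] by blast
  have "dchart q (X, tor (sqrt 2 * Im r / vv (fst q)) (sqrt 2 * Im k / uu (fst q))) = W"
  proof (rule eqI)
    have "of_real (Re r) + \<i> * of_real (Im r) = r" "of_real (Re k) + \<i> * of_real (Im k) = k"
      by (simp_all add: complex_eq[symmetric])
    moreover have "r * cis (az (snd q) / sqrt 2) = z W" "k * cis (aw (snd q) / sqrt 2) = w W"
      by (simp_all add: r_def k_def mult.assoc cis_mult)
    ultimately show "z (dchart q (X, tor (sqrt 2 * Im r / vv (fst q)) (sqrt 2 * Im k / uu (fst q)))) = z W"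
      "w (dchart q (X, tor (sqrt 2 * Im r / vv (fst q)) (sqrt 2 * Im k / uu (fst q)))) = w W"
      unfolding frame_chart using uv_facts(1,2)[OF p] by (simp_all add: X)
  qed
  then show ?thesis by blast
qed

lemma dchart_inj:
  assumes p: "fst (fst q) > 0" and eq: "dchart q X = 0"
  shows "X = 0"
proof -
  have "z (dchart q X) = 0" "w (dchart q X) = 0" using eq by simp_all
  then have "of_real (grad_v (fst q) \<bullet> fst X) + \<i> * of_real (vv (fst q) * (az (snd X) / sqrt 2)) = 0"
    "of_real (grad_u (fst q) \<bullet> fst X) + \<i> * of_real (uu (fst q) * (aw (snd X) / sqrt 2)) = 0"
    unfolding frame_chart by simp_all
  then have "grad_v (fst q) \<bullet> fst X = 0" "grad_u (fst q) \<bullet> fst X = 0" "az (snd X) = 0" "aw (snd X) = 0"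
    using uv_facts(1,2)[OF p] by (simp_all add: complex_eq_iff)
  then have "fst X \<bullet> fst X = 0" "snd X = tor 0 0"
    using inner_grad_uv[OF p, of "fst X" "fst X"] tor_eq[of "snd X"] by simp_all
  moreover have "tor 0 0 = 0" using tor_eq[of 0] bl_az bl_aw by (simp add: linear_simps)
  ultimately show ?thesis by (simp add: prod_eq_iff)
qed

text \<open>The coordinate structure is determined by the metric and the form, and both are pulled back from
  \<open>\<complex>\<^sup>2\<close> by a map with bijective derivative.\<close>

lemma coord_J:
  assumes p: "fst (fst q) > 0"
  shows "dchart q (tn_coord_J \<alpha> \<beta> q X) = J (tnc q) (dchart q X)"
proof -
  obtain Z where Z: "dchart q Z = J (tnc q) (dchart q X)" using dchart_surj[OF p] by metis
  have lin: "linear (dchart q)"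
    using has_derivative_linear[OF chart_der[OF p]] .
  have metric: "tn_coord_metric \<alpha> \<beta> q = (\<lambda>X Y. g (tnc q) (dchart q X) (dchart q Y))"
    using metric_pullback[OF p] by (simp add: fun_eq_iff)
  have "tn_coord_J \<alpha> \<beta> q X = Z"
    unfolding tn_coord_J_def
  proof (rule sharp_eqI)
    show "bilinear (tn_coord_metric \<alpha> \<beta> q)"
      using bilinear_g[of "tnc q"] linear_compose[OF lin]
      unfolding metric bilinear_def o_def by blast
    show "0 < tn_coord_metric \<alpha> \<beta> q Y Y" if "Y \<noteq> 0" for Y
      unfolding metric using dchart_inj[OF p] that by (intro g_pos) blast
    show "tn_coord_metric \<alpha> \<beta> q Z W = tn_coord_omega \<alpha> \<beta> q X W" for W
      unfolding metric Z form_pullback[OF p, symmetric] kaehler_form_def ..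
  qed
  then show ?thesis using Z by simp
qed

lemma chart_onto:
  assumes "z P \<noteq> 0" "w P \<noteq> 0"
  obtains q where "fst (fst q) > 0" "tnc q = P"
proof -
  define u v where "u = cmod (w P)" and "v = cmod (z P)"
  have uv: "u > 0" "v > 0" using assms by (simp_all add: u_def v_def)
  \<comment> \<open>The inverse of the conformal squaring map in \<open>polar_coords\<close>.\<close>
  define x y where "x = u * v / M" and "y = \<epsilon> * (u\<^sup>2 - v\<^sup>2) / (2 * M)"
  have "x\<^sup>2 + y\<^sup>2 = (4 * (u * v)\<^sup>2 + (\<epsilon> * \<epsilon>) * (u\<^sup>2 - v\<^sup>2)\<^sup>2) / (2 * M)\<^sup>2"
    using M_pos unfolding x_def y_def by (simp add: field_simps power2_eq_square)
  also have "\<dots> = ((u\<^sup>2 + v\<^sup>2) / (2 * M))\<^sup>2"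
    unfolding eps by (simp add: power_divide) (simp add: power2_eq_square algebra_simps)
  finally have r: "sqrt (x\<^sup>2 + y\<^sup>2) = (u\<^sup>2 + v\<^sup>2) / (2 * M)" using M_pos by simp
  have ey: "\<epsilon> * y = (u\<^sup>2 - v\<^sup>2) / (2 * M)"
    unfolding y_def using eps by (simp add: mult.assoc[symmetric])
  have "M * rad \<epsilon> (x, y) = u\<^sup>2" "M * rad (- \<epsilon>) (x, y) = v\<^sup>2"
    using M_pos unfolding rad_def by (simp_all add: r ey field_simps)
  then have "uu (x, y) = u" "vv (x, y) = v" unfolding uu_def vv_def using uv by simp_all
  then have "tnc ((x, y), tor (sqrt 2 * Arg (z P)) (sqrt 2 * Arg (w P))) = P"
    unfolding chart_eq vec_eq u_def v_def using rcis_cmod_Arg by (simp add: rcis_def)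
  moreover have "x > 0" using uv M_pos by (simp add: x_def)
  ultimately show ?thesis using that[of "((x, y), tor (sqrt 2 * Arg (z P)) (sqrt 2 * Arg (w P)))"] by simp
qed

text \<open>This gives the uniqueness in the definitions of the extended metric and complex structure.\<close>

lemma eq_on_dense:
  fixes f h :: "complex \<times> complex \<Rightarrow> 'b::real_normed_vector"
  assumes "smooth_on UNIV f" "smooth_on UNIV h" "\<And>P. z P \<noteq> 0 \<Longrightarrow> w P \<noteq> 0 \<Longrightarrow> f P = h P"
  shows "f P = h P"
proof -
  have "closed {P. f P = h P}"
    using assms(1,2) by (intro closed_Collect_eq smooth_on_continuous)
  then have "closure {P. z P \<noteq> 0 \<and> w P \<noteq> 0} \<subseteq> {P. f P = h P}"
    using assms(3) by (intro closure_minimal) auto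
  then show ?thesis unfolding dense_regular by blast
qed

lemma taub_nut_metric_eq: "taub_nut_metric \<alpha> \<beta> = g"
  unfolding taub_nut_metric_def
proof (rule the_equality)
  show "smooth_two_tensor UNIV g \<and> (\<forall>q\<in>tn_coord_dom. \<forall>X Y.
      g (tnc q) (tn_chart_deriv \<alpha> \<beta> q X) (tn_chart_deriv \<alpha> \<beta> q Y) = tn_coord_metric \<alpha> \<beta> q X Y)"
    using riemannian[of UNIV] unfolding riemannian_metric_def
    by (simp add: dom_iff chart_deriv_eq metric_pullback)
  fix h assume h: "smooth_two_tensor UNIV h \<and> (\<forall>q\<in>tn_coord_dom. \<forall>X Y.
      h (tnc q) (tn_chart_deriv \<alpha> \<beta> q X) (tn_chart_deriv \<alpha> \<beta> q Y) = tn_coord_metric \<alpha> \<beta> q X Y)"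
  have "h P X Y = g P X Y" for P X Y
  proof (rule eq_on_dense[where f = "\<lambda>P. h P X Y" and h = "\<lambda>P. g P X Y"])
    show "smooth_on UNIV (\<lambda>P. h P X Y)" using h unfolding smooth_two_tensor_def by blast
    fix P assume "z P \<noteq> 0" "w P \<noteq> 0"
    then obtain q where q: "fst (fst q) > 0" "tnc q = P" using chart_onto by blast
    then have "\<forall>X Y. h (tnc q) (tn_chart_deriv \<alpha> \<beta> q X) (tn_chart_deriv \<alpha> \<beta> q Y) = tn_coord_metric \<alpha> \<beta> q X Y"
      using h dom_iff by blast
    then have "h P (dchart q X) (dchart q Y) = g P (dchart q X) (dchart q Y)" for X Y
      unfolding chart_deriv_eq[OF q(1)] metric_pullback[OF q(1), symmetric] q(2) by blast
    then show "h P X Y = g P X Y" using dchart_surj[OF q(1)] by metis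
  qed (rule smooth_g)
  then show "h = g" by (simp add: fun_eq_iff)
qed

lemma taub_nut_J_eq: "taub_nut_J \<alpha> \<beta> = J"
  unfolding taub_nut_J_def
proof (rule the_equality)
  show "smooth_endo UNIV J \<and> (\<forall>q\<in>tn_coord_dom. \<forall>X.
      J (tnc q) (tn_chart_deriv \<alpha> \<beta> q X) = tn_chart_deriv \<alpha> \<beta> q (tn_coord_J \<alpha> \<beta> q X))"
    by (simp add: dom_iff chart_deriv_eq coord_J smooth_endo_cs)
  fix K assume K: "smooth_endo UNIV K \<and> (\<forall>q\<in>tn_coord_dom. \<forall>X.
      K (tnc q) (tn_chart_deriv \<alpha> \<beta> q X) = tn_chart_deriv \<alpha> \<beta> q (tn_coord_J \<alpha> \<beta> q X))"
  have J: "smooth_on UNIV (\<lambda>P. J P X)" for X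
    using smooth_endo_cs[of UNIV] unfolding smooth_endo_def by blast
  have "K P X = J P X" for P X
  proof (rule eq_on_dense[where f = "\<lambda>P. K P X" and h = "\<lambda>P. J P X", OF _ J])
    show "smooth_on UNIV (\<lambda>P. K P X)" using K unfolding smooth_endo_def by blast
    fix P assume "z P \<noteq> 0" "w P \<noteq> 0"
    then obtain q where q: "fst (fst q) > 0" "tnc q = P" using chart_onto by blast
    then have "\<forall>X. K (tnc q) (tn_chart_deriv \<alpha> \<beta> q X) = tn_chart_deriv \<alpha> \<beta> q (tn_coord_J \<alpha> \<beta> q X)"
      using K dom_iff by blast
    then have "K P (dchart q X) = J P (dchart q X)" for X
      unfolding chart_deriv_eq[OF q(1)] coord_J[OF q(1)] q(2) by blast
    then show "K P X = J P X" using dchart_surj[OF q(1)] by metis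
  qed
  then show "K = J" by (simp add: fun_eq_iff)
qed

lemma taub_nut_calabi: "qch_of_calabi_type UNIV (taub_nut_metric \<alpha> \<beta>) (taub_nut_J \<alpha> \<beta>)"
  unfolding taub_nut_metric_eq taub_nut_J_eq by (rule calabi_type_g)

end

section \<open>The exceptional generalized Taub-NUT surfaces\<close>

lemma heisenberg_frame_fst: "M > 0 \<Longrightarrow> heisenberg_frame (fst :: complex \<times> complex \<Rightarrow> complex) snd Pair (2 / M)"
  by (rule heisenberg_frame.intro) (simp_all add: bounded_linear_fst bounded_linear_snd)

lemma heisenberg_frame_snd: "M > 0 \<Longrightarrow> heisenberg_frame (snd :: complex \<times> complex \<Rightarrow> complex) fst (\<lambda>x y. (y, x)) (2 / M)"
  by (rule heisenberg_frame.intro) (simp_all add: bounded_linear_fst bounded_linear_snd)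

lemma taub_nut_frame_beta_0:
  assumes "\<gamma> > 0"
  shows "taub_nut_frame fst snd Pair (\<gamma> / (2 * sqrt 2)) \<gamma> 0 1 fst snd Pair (psi1 \<gamma>) (psi2 0)"
proof (intro taub_nut_frame.intro heisenberg_frame_fst taub_nut_frame_axioms.intro)
  show "psi1 \<gamma> = (\<lambda>p. rad (- 1) p / sqrt 2 + sqrt 2 * (\<gamma> / (2 * sqrt 2)) * (fst p)\<^sup>2)"
    "psi2 0 = (\<lambda>p. rad 1 p / sqrt 2)"
    by (simp_all add: fun_eq_iff psi1_def psi2_def rad_def)
  show "tn_chart \<gamma> 0 (p, \<theta>) = (complex_of_real (sqrt (\<gamma> / (2 * sqrt 2) * rad (- 1) p)) * cis (fst \<theta> / sqrt 2),
      complex_of_real (sqrt (\<gamma> / (2 * sqrt 2) * rad 1 p)) * cis (snd \<theta> / sqrt 2))" for p \<theta>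
    by (cases p; cases \<theta>) (simp only: tn_chart_def tn_M_def rad_def case_prod_conv Let_def fst_conv snd_conv, simp)
qed (use assms in \<open>simp_all add: tn_M_def tn_k_def bounded_linear_fst bounded_linear_snd
   tn_coord_metric_def tn_coord_omega_def case_prod_beta\<close>)

lemma taub_nut_frame_alpha_0:
  assumes "\<gamma> > 0"
  shows "taub_nut_frame snd fst (\<lambda>x y. (y, x)) (\<gamma> / (2 * sqrt 2)) 0 \<gamma> (- 1) snd fst (\<lambda>x y. (y, x)) (psi2 \<gamma>) (psi1 0)"
proof (intro taub_nut_frame.intro heisenberg_frame_snd taub_nut_frame_axioms.intro)
  show "psi2 \<gamma> = (\<lambda>p. rad (- (- 1)) p / sqrt 2 + sqrt 2 * (\<gamma> / (2 * sqrt 2)) * (fst p)\<^sup>2)"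
    "psi1 0 = (\<lambda>p. rad (- 1) p / sqrt 2)"
    by (simp_all add: fun_eq_iff psi1_def psi2_def rad_def)
  show "tn_chart 0 \<gamma> (p, \<theta>) = (complex_of_real (sqrt (\<gamma> / (2 * sqrt 2) * rad (- 1) p)) * cis (fst \<theta> / sqrt 2),
      complex_of_real (sqrt (\<gamma> / (2 * sqrt 2) * rad (- (- 1)) p)) * cis (snd \<theta> / sqrt 2))" for p \<theta>
    by (cases p; cases \<theta>) (simp only: tn_chart_def tn_M_def rad_def case_prod_conv Let_def fst_conv snd_conv, simp)
qed (use assms in \<open>simp_all add: tn_M_def tn_k_def bounded_linear_fst bounded_linear_snd
   tn_coord_metric_def tn_coord_omega_def case_prod_beta\<close>)

theorem theorem4p1:
  fixes \<alpha> \<beta> k :: real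
  assumes "\<alpha> \<ge> 0" and "\<beta> \<ge> 0" and "\<alpha> + \<beta> > 0"
    and "k = (\<alpha> - \<beta>) / (\<alpha> + \<beta>)"
    and "k \<in> {-1, 1}"
  shows "qch_of_calabi_type UNIV (taub_nut_metric \<alpha> \<beta>) (taub_nut_J \<alpha> \<beta>)"
proof -
  have "\<alpha> - \<beta> = k * (\<alpha> + \<beta>)" using assms(3,4) by simp
  then consider "\<beta> = 0" "\<alpha> > 0" | "\<alpha> = 0" "\<beta> > 0"
    using assms(3,5) by force
  then show ?thesis
  proof cases
    case 1
    then show ?thesis using taub_nut_frame.taub_nut_calabi[OF taub_nut_frame_beta_0] by simp
  next
    case 2
    then show ?thesis using taub_nut_frame.taub_nut_calabi[OF taub_nut_frame_alpha_0] by simp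
  qed
qed

end
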